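(* Let $X\neq\{0\}$ be a complex Banach space with open unit ball $\mathbb{B}$, let $k\geq 1$ be an integer, let $f:\mathbb{B}\to\mathbb{C}$ be holomorphic, and suppose that the mapping $F(z)=z f(z)$ belongs to $\mathcal{S}^*(\mathbb{B})$. If $F(z)-z$ has a zero of order $k+1$ at $z=0$, then for every $z\in\mathbb{B}\setminus\{0\}$ and every $l_z\in T_z$, $$ \left\vert \left(\frac{l_z\big(D^{2k+1}F(0)(z^{2k+1})\big)}{(2k+1)!\,\|z\|^{2k+1}}\right)^2 - \left(\frac{l_z\big(D^{k+1}F(0)(z^{k+1})\big)}{(k+1)!\,\|z\|^{k+1}}\right)^2 \right\vert \leq \frac{(k+2)^2}{k^4}+\frac{4}{k^2}. $$ The bound is sharp: for every such $X$ and $k$ there are a mapping $F$ satisfying the hypotheses, a point $z\in\mathbb{B}\setminus\{0\}$ and $l_z\in T_z$ for which equality holds.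
   Context: For $z\in X\setminus\{0\}$, $T_z=\{l_z: X\to\mathbb{C} \text{ continuous linear}: l_z(z)=\|z\|,\ \|l_z\|=1\}$ (non-empty by Hahn–Banach). For a holomorphic mapping $F$ on a neighbourhood of $0$ in $X$ and an integer $m\ge1$, $D^mF(0)$ is the $m$-th Fréchet derivative at $0$, a bounded symmetric $m$-linear mapping, and $D^mF(0)(z^m)=D^mF(0)(z,\dots,z)$ ($m$ times). A holomorphic mapping $F:\mathbb{B}\to X$ is normalized if $F(0)=0$ and $DF(0)=I$ (identity operator on $X$), and locally biholomorphic if $DF(z)$ has a bounded inverse for each $z\in\mathbb{B}$. The class $\mathcal{S}^*(\mathbb{B})$ of starlike mappings on $\mathbb{B}$ consists of all normalized locally biholomorphic mappings $F:\mathbb{B}\to X$ such that $\operatorname{Re}\big(l_z([DF(z)]^{-1}F(z))\big)>0$ for all $z\in\mathbb{B}\setminus\{0\}$ and all $l_z\in T_z$. A holomorphic mapping $g$ from a domain of $X$ containing $0$ into $X$ has a zero of order $m$ at $z=0$ ($m\in\mathbb{N}$) if $g(0)=0$, $Dg(0)=0,\dots,D^{m-1}g(0)=0$ and $D^{m}g(0)\neq 0$. *)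

theory Defs
  imports "HOL-Analysis.Analysis"
begin

class complex_normed_vector = real_normed_vector +
  fixes scaleC :: "complex \<Rightarrow> 'a \<Rightarrow> 'a"  (infixr \<open>*\<^sub>C\<close> 75)
  assumes scaleC_add_right: "a *\<^sub>C (x + y) = a *\<^sub>C x + a *\<^sub>C y"
    and scaleC_add_left: "(a + b) *\<^sub>C x = a *\<^sub>C x + b *\<^sub>C x"
    and scaleC_scaleC: "a *\<^sub>C b *\<^sub>C x = (a * b) *\<^sub>C x"
    and scaleC_of_real: "complex_of_real r *\<^sub>C x = r *\<^sub>R x"
    and norm_scaleC: "norm (a *\<^sub>C x) = cmod a * norm x"

class complex_banach = complex_normed_vector + banach

instantiation complex :: complex_banach
begin

definition scaleC_complex :: "complex \<Rightarrow> complex \<Rightarrow> complex" where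
  "scaleC_complex a x = a * x"

instance
  by standard (auto simp: scaleC_complex_def algebra_simps norm_mult scaleR_conv_of_real)

end

definition bounded_clinear ::
  "('a::complex_normed_vector \<Rightarrow> 'b::complex_normed_vector) \<Rightarrow> bool" where
  "bounded_clinear L \<longleftrightarrow> bounded_linear L \<and> (\<forall>c x. L (c *\<^sub>C x) = c *\<^sub>C L x)"

text \<open>Holomorphy is complex Frechet differentiability; the set is meant to be open.\<close>

definition frechet_holomorphic_on ::
  "('a::complex_normed_vector \<Rightarrow> 'b::complex_normed_vector) \<Rightarrow> 'a set \<Rightarrow> bool" where
  "frechet_holomorphic_on F U \<longleftrightarrow>
     (\<forall>z\<in>U. \<exists>L. bounded_clinear L \<and> (F has_derivative L) (at z))"

text \<open>
  \<open>frechet_D F [h\<^sub>1, \<dots>, h\<^sub>m] z\<close> is the value \<open>D\<^sup>m F(z)(h\<^sub>1, \<dots>, h\<^sub>m)\<close> of the \<open>m\<close>-th Frechet derivative.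
  The spaces of \<open>m\<close>-linear mappings have types that depend on \<open>m\<close>, so the recursion
  \<open>D\<^sup>m\<^sup>+\<^sup>1 F = D(D\<^sup>m F)\<close> is written after evaluation at the remaining arguments. Evaluation is
  bounded linear, hence \<open>D(D\<^sup>m F)(z)(h)(hs) = D(w \<mapsto> D\<^sup>m F(w)(hs))(z)(h)\<close>.
\<close>

primrec frechet_D ::
  "('a::real_normed_vector \<Rightarrow> 'b::real_normed_vector) \<Rightarrow> 'a list \<Rightarrow> 'a \<Rightarrow> 'b" where
  "frechet_D F [] = F"
| "frechet_D F (h # hs) = (\<lambda>z. frechet_derivative (frechet_D F hs) (at z) h)"

definition zero_of_order ::
  "('a::real_normed_vector \<Rightarrow> 'b::real_normed_vector) \<Rightarrow> nat \<Rightarrow> bool" where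
  "zero_of_order g m \<longleftrightarrow>
     (\<forall>j<m. \<forall>hs. length hs = j \<longrightarrow> frechet_D g hs 0 = 0) \<and>
     (\<exists>hs. length hs = m \<and> frechet_D g hs 0 \<noteq> 0)"

definition support_functionals ::
  "'a::complex_normed_vector \<Rightarrow> ('a \<Rightarrow> complex) set" where
  "support_functionals z =
     {l. bounded_clinear l \<and> l z = complex_of_real (norm z) \<and> onorm l = 1}"

definition normalized_mapping :: "('a::complex_normed_vector \<Rightarrow> 'a) \<Rightarrow> bool" where
  "normalized_mapping F \<longleftrightarrow> F 0 = 0 \<and> frechet_derivative F (at 0) = id"

definition locally_biholomorphic :: "('a::complex_normed_vector \<Rightarrow> 'a) \<Rightarrow> bool" where
  "locally_biholomorphic F \<longleftrightarrow>
     (\<forall>z\<in>ball 0 1. bij (frechet_derivative F (at z)) \<and>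
                   bounded_clinear (inv (frechet_derivative F (at z))))"

text \<open>
  A mapping of the unit ball is represented by a total function. Its values off the open ball
  are irrelevant, since only values and derivatives at points of the ball enter.
\<close>

definition starlike_mappings :: "('a::complex_normed_vector \<Rightarrow> 'a) set" where
  "starlike_mappings = {F.
     frechet_holomorphic_on F (ball 0 1) \<and> normalized_mapping F \<and> locally_biholomorphic F \<and>
     (\<forall>z\<in>ball 0 1 - {0}. \<forall>l\<in>support_functionals z.
        Re (l (inv (frechet_derivative F (at z)) (F z))) > 0)}"

end

theory Submission
  imports Defs "HOL-Complex_Analysis.Complex_Analysis"
begin

text \<open>
  Fix \<open>u\<close> with \<open>norm u = 1\<close> and put \<open>\<phi> \<zeta> = f (\<zeta> u)\<close>. The operator \<open>DF(z)\<close> maps \<open>z\<close> to a multiple of \<open>z\<close>,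
  so starlikeness of \<open>F\<close> says that \<open>p \<zeta> = 1 + \<zeta> \<phi>'(\<zeta>) / \<phi> \<zeta>\<close> has positive real part on the disc,
  and the normalized derivatives of \<open>F\<close> at 0 are the Taylor coefficients of \<open>\<phi>\<close>. Comparing coefficients
  in \<open>\<zeta> \<phi>' = \<phi> (p - 1)\<close> gives \<open>k \<phi>\<^sub>k = p\<^sub>k\<close> and \<open>2k \<phi>\<^sub>2\<^sub>k = p\<^sub>2\<^sub>k + \<phi>\<^sub>k p\<^sub>k\<close>, and the bound follows from
  Caratheodory's inequality \<open>|p\<^sub>n| \<le> 2\<close>. Equality holds for \<open>p \<zeta> = (1 + \<i> \<zeta>^k) / (1 - \<i> \<zeta>^k)\<close>, which
  is transported to the space by a support functional.
\<close>

section \<open>Complex Frechet derivatives of scalar functions\<close>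

text \<open>The derivatives in the statement are nested: \<open>frechet_D\<close> differentiates a
  map that has already been evaluated at other directions. In infinite dimension this needs
  \<open>w \<mapsto> Df(w)(h)\<close> to be complex Frechet differentiable again, which
  differentiability along single lines does not give; Cauchy estimates that are uniform in the
  direction do. Only the scalar factor \<open>f\<close> requires them, since a Leibniz rule passes
  from \<open>f\<close> to \<open>F\<close>. The two squares are estimated separately, by
  \<open>|\<phi>_k| \<le> 2/k\<close> and
  \<open>|\<phi>_2k| \<le> (2 + 4/k)/(2k) = (k + 2)/k^2\<close>. The triangle inequality between
  them is sharp only if the squares point in opposite directions. For
  \<open>(1 + \<zeta>^k)/(1 - \<zeta>^k)\<close> both would be positive; the rotation by
  \<open>\<i>\<close> makes the square of \<open>\<phi>_k\<close> negative and keeps that of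
  \<open>\<phi>_2k\<close> positive.\<close>

lemma bounded_bilinear_scaleC:
  "bounded_bilinear (scaleC :: complex \<Rightarrow> 'a::complex_normed_vector \<Rightarrow> 'a)"
proof
  show "\<exists>K. \<forall>a (b :: 'a). norm (a *\<^sub>C b) \<le> norm a * norm b * K"
    by (rule exI[of _ 1]) (simp add: norm_scaleC)
  show "(r *\<^sub>R a) *\<^sub>C b = r *\<^sub>R a *\<^sub>C b" for r a and b :: 'a
    by (metis scaleC_of_real scaleC_scaleC scaleR_conv_of_real)
  show "a *\<^sub>C r *\<^sub>R b = r *\<^sub>R a *\<^sub>C b" for r a and b :: 'a
    by (metis mult.commute scaleC_of_real scaleC_scaleC)
qed (simp_all add: scaleC_add_left scaleC_add_right)

interpretation scaleC: bounded_bilinear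
  "scaleC :: complex \<Rightarrow> 'a::complex_normed_vector \<Rightarrow> 'a"
  by (rule bounded_bilinear_scaleC)

lemma scaleC_one [simp]: "1 *\<^sub>C x = (x :: 'a::complex_normed_vector)"
  using scaleC_of_real[of 1 x] by simp

lemma bounded_clinear_imp_bounded_linear: "bounded_clinear L \<Longrightarrow> bounded_linear L"
  by (simp add: bounded_clinear_def)

lemma bounded_clinear_scaleC: "bounded_clinear L \<Longrightarrow> L (c *\<^sub>C x) = c *\<^sub>C L x"
  by (simp add: bounded_clinear_def)

lemma bounded_clinear_scaleC_complex:
  "bounded_clinear L \<Longrightarrow> L (c *\<^sub>C x) = c * (L x :: complex)"
  by (simp add: bounded_clinear_def scaleC_complex_def)

lemma frechet_holomorphic_onD:
  assumes "frechet_holomorphic_on F U" and "z \<in> U"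
  shows "(F has_derivative frechet_derivative F (at z)) (at z)"
    and "bounded_clinear (frechet_derivative F (at z))"
proof -
  obtain L where L: "bounded_clinear L" "(F has_derivative L) (at z)"
    using assms unfolding frechet_holomorphic_on_def by blast
  then have "frechet_derivative F (at z) = L"
    using frechet_derivative_at by metis
  with L show "(F has_derivative frechet_derivative F (at z)) (at z)"
    "bounded_clinear (frechet_derivative F (at z))"
    by simp_all
qed

lemma frechet_holomorphic_onI:
  assumes "\<And>z. z \<in> U \<Longrightarrow> (F has_derivative L z) (at z)"
    and "\<And>z. z \<in> U \<Longrightarrow> bounded_clinear (L z)"
  shows "frechet_holomorphic_on F U"
  using assms unfolding frechet_holomorphic_on_def by blast

text \<open>Complex linearity of \<open>L\<close> turns the real derivative of the slice into
  multiplication by the number \<open>L h\<close>, which opens every line to one-variable complex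
  analysis.\<close>

lemma has_field_derivative_along_line:
  fixes f :: "'a::complex_normed_vector \<Rightarrow> complex"
  assumes "(f has_derivative L) (at (a + \<zeta> *\<^sub>C h))" and "bounded_clinear L"
  shows "((\<lambda>\<zeta>. f (a + \<zeta> *\<^sub>C h)) has_field_derivative L h) (at \<zeta>)"
proof -
  have "((\<lambda>\<zeta>. a + \<zeta> *\<^sub>C h) has_derivative (\<lambda>\<eta>. \<eta> *\<^sub>C h)) (at \<zeta>)"
    using has_derivative_add[OF has_derivative_const
        bounded_linear.has_derivative[OF scaleC.bounded_linear_left has_derivative_ident]]
    by simp
  from has_derivative_compose[OF this assms(1)]
  show ?thesis
    unfolding has_field_derivative_def
    by (simp add: bounded_clinear_scaleC_complex[OF assms(2)] mult_commute_abs)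
qed

lemma holomorphic_on_along_line:
  fixes f :: "'a::complex_normed_vector \<Rightarrow> complex"
  assumes "frechet_holomorphic_on f U" and "\<And>\<zeta>. \<zeta> \<in> S \<Longrightarrow> a + \<zeta> *\<^sub>C h \<in> U" and "open S"
  shows "(\<lambda>\<zeta>. f (a + \<zeta> *\<^sub>C h)) holomorphic_on S"
proof -
  have "((\<lambda>\<zeta>. f (a + \<zeta> *\<^sub>C h)) has_field_derivative
           frechet_derivative f (at (a + \<zeta> *\<^sub>C h)) h) (at \<zeta>)" if "\<zeta> \<in> S" for \<zeta>
    using that assms by (intro has_field_derivative_along_line frechet_holomorphic_onD) auto
  then show ?thesis
    by (metis assms(3) holomorphic_on_open)
qed

text \<open>Cauchy's inequality on the slice through \<open>x\<close> in direction \<open>v\<close>.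
  The available disc has radius \<open>r / norm v\<close>, so the bound is linear in
  \<open>norm v\<close>: it controls the operator norm.\<close>

lemma norm_frechet_derivative_le:
  fixes f :: "'a::complex_normed_vector \<Rightarrow> complex"
  assumes holf: "frechet_holomorphic_on f (ball x r)" and "0 < r"
    and bound: "\<And>w. w \<in> ball x r \<Longrightarrow> cmod (f w) \<le> M"
  shows "cmod (frechet_derivative f (at x) v) \<le> 2 * M / r * norm v"
proof (cases "v = 0")
  case True
  have "bounded_clinear (frechet_derivative f (at x))"
    using frechet_holomorphic_onD(2)[OF holf] \<open>0 < r\<close> by simp
  then show ?thesis
    using True linear_0[OF bounded_linear.linear[OF bounded_clinear_imp_bounded_linear]] by simp
next
  case False
  \<comment> \<open>Half the radius at which the line may leave the ball, so that the closed disc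
    stays inside; the halving is the 2 in the bound.\<close>
  define s where "s = r / (2 * norm v)"
  have s: "0 < s" "s * norm v < r"
    using False \<open>0 < r\<close> by (auto simp: s_def)
  let ?\<psi> = "\<lambda>\<zeta>. f (x + \<zeta> *\<^sub>C v)"
  have in_ball: "x + \<zeta> *\<^sub>C v \<in> ball x r" if "cmod \<zeta> < r / norm v" for \<zeta>
    using that False by (simp add: dist_norm norm_scaleC field_simps)
  have hol: "?\<psi> holomorphic_on ball 0 (r / norm v)"
    by (rule holomorphic_on_along_line[OF holf in_ball]) auto
  have sub: "cball 0 s \<subseteq> ball (0::complex) (r / norm v)"
    using s False by (intro cball_subset_ball_iff[THEN iffD2]) (simp add: field_simps)
  have "cmod ((deriv ^^ 1) ?\<psi> 0) \<le> fact 1 * M / s ^ 1"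
  proof (rule Cauchy_inequality)
    show "?\<psi> holomorphic_on ball 0 s"
      using hol sub ball_subset_cball by (meson holomorphic_on_subset)
    show "continuous_on (cball 0 s) ?\<psi>"
      using holomorphic_on_imp_continuous_on[OF hol] sub continuous_on_subset by blast
    show "cmod (f (x + \<zeta> *\<^sub>C v)) \<le> M" if "cmod (0 - \<zeta>) = s" for \<zeta>
      using that sub by (intro bound in_ball) (auto simp: subset_iff)
  qed fact
  moreover have "(?\<psi> has_field_derivative frechet_derivative f (at x) v) (at 0)"
    using has_field_derivative_along_line[of f "frechet_derivative f (at x)" x 0 v]
      frechet_holomorphic_onD[OF holf] \<open>0 < r\<close> by (simp add: scaleC.zero_left)
  ultimately show ?thesis
    by (simp add: DERIV_imp_deriv s_def field_simps)
qed

text \<open>Remainder of the first-order Taylor polynomial. Discs of radius \<open>R / 2\<close>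
  about points of \<open>cball 0 R\<close> stay in \<open>ball 0 (2 * R)\<close>, so the second
  derivative is at most \<open>2 * M / (R / 2)^2\<close>, whence the 8. Only \<open>M\<close> and
  \<open>R\<close> enter, so the rate is common to all slices.\<close>

lemma difference_quotient_bound:
  fixes \<psi> :: "complex \<Rightarrow> complex"
  assumes hol: "\<psi> holomorphic_on ball 0 (2 * R)" and "0 < R"
    and bound: "\<And>\<zeta>. \<zeta> \<in> ball 0 (2 * R) \<Longrightarrow> cmod (\<psi> \<zeta>) \<le> M"
    and t: "t \<noteq> 0" "cmod t \<le> R"
  shows "cmod ((\<psi> t - \<psi> 0) / t - deriv \<psi> 0) \<le> 8 * M / R\<^sup>2 * cmod t"
proof -
  have "cmod ((deriv ^^ 2) \<psi> \<zeta>) \<le> fact 2 * M / (R / 2)\<^sup>2" if "\<zeta> \<in> cball 0 R" for \<zeta>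
  proof (rule Cauchy_inequality)
    have sub: "cball \<zeta> (R / 2) \<subseteq> ball 0 (2 * R)"
      using that \<open>0 < R\<close>
      by (intro cball_subset_ball_iff[THEN iffD2]) auto
    show "\<psi> holomorphic_on ball \<zeta> (R / 2)"
      using hol sub ball_subset_cball by (meson holomorphic_on_subset)
    show "continuous_on (cball \<zeta> (R / 2)) \<psi>"
      using holomorphic_on_imp_continuous_on[OF hol] sub continuous_on_subset by blast
    show "cmod (\<psi> \<xi>) \<le> M" if "cmod (\<zeta> - \<xi>) = R / 2" for \<xi>
      using that sub by (intro bound) (auto simp: subset_iff dist_norm)
  qed (use \<open>0 < R\<close> in simp)
  then have second: "cmod ((deriv ^^ 2) \<psi> \<zeta>) \<le> 8 * M / R\<^sup>2" if "\<zeta> \<in> cball 0 R" for \<zeta>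
    using that by (simp add: power_divide del: funpow.simps)
  have "cmod ((deriv ^^ 0) \<psi> t - (\<Sum>i\<le>1. (deriv ^^ i) \<psi> 0 * (t - 0) ^ i / fact i))
          \<le> 8 * M / R\<^sup>2 * cmod (t - 0) ^ Suc 1 / fact 1"
  proof (rule complex_Taylor[of "cball 0 R"])
    fix i \<zeta> assume "\<zeta> \<in> cball (0::complex) R"
    then have "(deriv ^^ i) \<psi> holomorphic_on ball 0 (2 * R)" "\<zeta> \<in> ball 0 (2 * R)"
      using \<open>0 < R\<close> by (auto intro: holomorphic_higher_deriv hol)
    then show "((deriv ^^ i) \<psi> has_field_derivative (deriv ^^ Suc i) \<psi> \<zeta>) (at \<zeta> within cball 0 R)"
      by (simp add: has_field_derivative_at_within holomorphic_derivI[OF _ open_ball])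
  qed (use second t \<open>0 < R\<close> in \<open>auto simp: numeral_2_eq_2\<close>)
  then have "cmod (\<psi> t - \<psi> 0 - deriv \<psi> 0 * t) \<le> 8 * M / R\<^sup>2 * cmod t ^ 2"
    by (simp add: algebra_simps power2_eq_square)
  moreover have "\<psi> t - \<psi> 0 - deriv \<psi> 0 * t = ((\<psi> t - \<psi> 0) / t - deriv \<psi> 0) * t"
    using t by (simp add: field_simps)
  ultimately have "cmod ((\<psi> t - \<psi> 0) / t - deriv \<psi> 0) * cmod t \<le> (8 * M / R\<^sup>2 * cmod t) * cmod t"
    by (simp add: norm_mult power2_eq_square)
  then show ?thesis
    using t(1) mult_right_le_imp_le by (metis zero_less_norm_iff)
qed

text \<open>Letting \<open>m\<close> tend to infinity in the hypothesis hands the explicit rate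
  \<open>t\<close> on to the limit. This rate later gives uniformity in the point and the
  direction.\<close>

lemma convergent_of_vanishing_bound:
  fixes a :: "nat \<Rightarrow> 'b::banach"
  assumes t: "t \<longlonglongrightarrow> (0::real)"
    and bound: "\<And>n m. norm (a n - a m) \<le> t n + t m"
  obtains l where "a \<longlonglongrightarrow> l" and "\<And>n. norm (a n - l) \<le> t n"
proof -
  have "Cauchy a"
  proof (rule CauchyI)
    fix e :: real assume "0 < e"
    then have "eventually (\<lambda>n. t n < e / 2) sequentially"
      using order_tendstoD(2)[OF t, of "e / 2"] by simp
    then obtain N where N: "\<And>n. n \<ge> N \<Longrightarrow> t n < e / 2"
      unfolding eventually_sequentially by blast
    have "norm (a m - a n) < e" if "m \<ge> N" "n \<ge> N" for m n
      using bound[of m n] N[OF that(1)] N[OF that(2)] by simp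
    then show "\<exists>N. \<forall>m\<ge>N. \<forall>n\<ge>N. norm (a m - a n) < e" by blast
  qed
  then obtain l where l: "a \<longlonglongrightarrow> l"
    using Cauchy_convergent convergent_def by blast
  moreover have "norm (a n - l) \<le> t n" for n
  proof (rule LIMSEQ_le)
    show "(\<lambda>m. norm (a n - a m)) \<longlonglongrightarrow> norm (a n - l)"
      by (intro tendsto_intros l)
    show "(\<lambda>m. t n + t m) \<longlonglongrightarrow> t n"
      using tendsto_add[OF tendsto_const t] by simp
  qed (use bound in blast)
  ultimately show thesis using that by blast
qed

lemma frechet_holomorphic_on_difference_quotient:
  fixes f :: "'a::complex_normed_vector \<Rightarrow> complex"
  assumes "frechet_holomorphic_on f U" and "\<And>w. w \<in> V \<Longrightarrow> w \<in> U \<and> w + v \<in> U"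
  shows "frechet_holomorphic_on (\<lambda>w. (f (w + v) - f w) / t) V"
proof (rule frechet_holomorphic_onI)
  fix w assume "w \<in> V"
  then have "w \<in> U" "w + v \<in> U" using assms(2) by auto
  note D = frechet_holomorphic_onD[OF assms(1) this(1)] frechet_holomorphic_onD[OF assms(1) this(2)]
  let ?L = "\<lambda>h. (frechet_derivative f (at (w + v)) h - frechet_derivative f (at w) h) / t"
  have shift: "((\<lambda>w. w + v) has_derivative (\<lambda>h. h)) (at w)"
    by (auto intro!: derivative_eq_intros)
  show *: "((\<lambda>w. (f (w + v) - f w) / t) has_derivative ?L) (at w)"
    using bounded_linear.has_derivative[OF bounded_linear_divide
        has_derivative_diff[OF has_derivative_compose[OF shift D(3)] D(1)]] by simp
  show "bounded_clinear ?L"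
    unfolding bounded_clinear_def
    using has_derivative_bounded_linear[OF *] D(2,4)
    by (simp add: bounded_clinear_scaleC_complex scaleC_complex_def right_diff_distrib[symmetric])
qed

text \<open>The difference quotients of \<open>f\<close> in direction \<open>h\<close> converge locally uniformly by the
  second-order Cauchy estimate, and then so do their derivatives by the first-order one.\<close>

lemma frechet_holomorphic_on_derivative:
  fixes f :: "'a::complex_normed_vector \<Rightarrow> complex"
  assumes holf: "frechet_holomorphic_on f U" and "open U"
  shows "frechet_holomorphic_on (\<lambda>w. frechet_derivative f (at w) h) U"
  unfolding frechet_holomorphic_on_def
proof
  fix x0 assume "x0 \<in> U"
  let ?D = "\<lambda>w. frechet_derivative f (at w)"
  \<comment> \<open>Closed balls need not be compact here, so the local bound \<open>M\<close> is
    drawn from continuity at \<open>x0\<close>.\<close>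
  have "isCont f x0"
    using frechet_holomorphic_onD(1)[OF holf \<open>x0 \<in> U\<close>] has_derivative_continuous by blast
  then obtain d1 where d1: "0 < d1" "\<And>w. dist w x0 < d1 \<Longrightarrow> dist (f w) (f x0) < 1"
    unfolding continuous_at_eps_delta by (metis zero_less_one)
  obtain d2 where d2: "0 < d2" "ball x0 d2 \<subseteq> U"
    using \<open>open U\<close> \<open>x0 \<in> U\<close> openE by blast
  \<comment> \<open>Three nested balls: \<open>f\<close> is bounded on radius
    \<open>4 * \<rho>\<close>, the quotients \<open>g n\<close> are treated on
    \<open>2 * \<rho>\<close>, and limits are taken on \<open>\<rho>\<close>, which leaves a ball of
    radius \<open>\<rho>\<close> about each point for the Cauchy estimate.\<close>
  define \<rho> where "\<rho> = min d1 d2 / 4"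
  define M where "M = cmod (f x0) + 1"
  have \<rho>: "0 < \<rho>" using d1 d2 by (simp add: \<rho>_def)
  have sub: "ball x0 (4 * \<rho>) \<subseteq> U" using d2 by (auto simp: \<rho>_def)
  have M: "cmod (f w) \<le> M" if "w \<in> ball x0 (4 * \<rho>)" for w
  proof -
    have "dist (f w) (f x0) < 1" using that by (intro d1) (auto simp: \<rho>_def dist_commute)
    then show ?thesis using norm_triangle_sub[of "f w" "f x0"] by (simp add: M_def dist_norm)
  qed
  \<comment> \<open>Parameters below \<open>2 * R\<close> move a point in direction \<open>h\<close>
    by less than \<open>2 * \<rho>\<close>; the \<open>+ 1\<close> also covers
    \<open>h = 0\<close>.\<close>
  define R where "R = \<rho> / (norm h + 1)"
  have R: "0 < R" using \<rho> by (simp add: R_def add_nonneg_pos)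
  have Rh: "R * norm h < \<rho>"
    using \<rho> by (simp add: R_def divide_less_eq add_nonneg_pos)
  define t where "t n = R / real (Suc n)" for n
  have t: "0 < t n" "t n \<le> R" for n
    using R by (auto simp: t_def divide_le_eq)
  have t_lim: "(\<lambda>n. c * t n) \<longlonglongrightarrow> 0" for c
    using tendsto_mult_right_zero[OF LIMSEQ_Suc[OF lim_const_over_n[of R]]] by (simp add: t_def)
  define B where "B = 8 * M / R\<^sup>2"
  define g where "g n w = (f (w + complex_of_real (t n) *\<^sub>C h) - f w) / complex_of_real (t n)" for n w
  have step: "w + \<zeta> *\<^sub>C h \<in> ball x0 (4 * \<rho>)" if "w \<in> ball x0 (2 * \<rho>)" "cmod \<zeta> < 2 * R" for w \<zeta>
  proof -
    have "norm (\<zeta> *\<^sub>C h) \<le> 2 * R * norm h"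
      using that by (simp add: norm_scaleC mult_right_mono)
    then have "norm (\<zeta> *\<^sub>C h) < 2 * \<rho>" using Rh by simp
    then have "dist w (w + \<zeta> *\<^sub>C h) < 2 * \<rho>" by (simp add: dist_norm)
    then show ?thesis using that(1) dist_triangle[of x0 "w + \<zeta> *\<^sub>C h" w] by simp
  qed
  have close: "cmod (g n w - ?D w h) \<le> B * t n" if w: "w \<in> ball x0 (2 * \<rho>)" for n w
  proof -
    let ?\<psi> = "\<lambda>\<zeta>. f (w + \<zeta> *\<^sub>C h)"
    have "w \<in> U" using w sub \<rho> by auto
    then have "(?\<psi> has_field_derivative ?D w h) (at 0)"
      using has_field_derivative_along_line[of f "?D w" w 0 h] frechet_holomorphic_onD[OF holf]
      by (simp add: scaleC.zero_left)
    then have "deriv ?\<psi> 0 = ?D w h" by (rule DERIV_imp_deriv)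
    moreover have "cmod ((?\<psi> (t n) - ?\<psi> 0) / t n - deriv ?\<psi> 0) \<le> 8 * M / R\<^sup>2 * cmod (t n)"
    proof (rule difference_quotient_bound)
      show "?\<psi> holomorphic_on ball 0 (2 * R)"
        using step[OF w] sub by (intro holomorphic_on_along_line[OF holf]) auto
    qed (use step[OF w] M t[of n] R in auto)
    ultimately show ?thesis
      using t[of n] by (simp add: g_def B_def scaleC.zero_left)
  qed
  have holg: "frechet_holomorphic_on (g n) (ball x0 (2 * \<rho>))" for n
    unfolding g_def
  proof (rule frechet_holomorphic_on_difference_quotient[OF holf])
    fix w assume "w \<in> ball x0 (2 * \<rho>)"
    then show "w \<in> U \<and> w + complex_of_real (t n) *\<^sub>C h \<in> U"
      using step[of w "t n"] step[of w 0] sub t[of n] R by (auto simp: scaleC.zero_left)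
  qed
  let ?S = "ball x0 \<rho>"
  let ?G = "\<lambda>n x. frechet_derivative (g n) (at x)"
  define K where "K = 2 * B / \<rho>"
  have in2: "w \<in> ball x0 (2 * \<rho>)" if "x \<in> ?S" "w \<in> ball x \<rho>" for x w
    using that dist_triangle[of x0 w x] by simp
  have self2: "x \<in> ball x0 (2 * \<rho>)" if "x \<in> ?S" for x
    using that \<rho> by simp
  note DG = frechet_holomorphic_onD[OF holg self2]
  \<comment> \<open>The limit \<open>?D w h\<close> is not yet known to be differentiable, so the
    Cauchy estimate is applied to the holomorphic differences \<open>g n - g m\<close>, whose size
    follows from \<open>close\<close> used twice.\<close>
  have cauchy: "cmod (?G n x v - ?G m x v) \<le> K * norm v * t n + K * norm v * t m"
    if x: "x \<in> ?S" for n m x v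
  proof -
    let ?d = "\<lambda>w. g n w - g m w"
    have hd: "(?d has_derivative (\<lambda>v. ?G n w v - ?G m w v)) (at w)"
      and bc: "bounded_clinear (\<lambda>v. ?G n w v - ?G m w v)" if "w \<in> ball x0 (2 * \<rho>)" for w
    proof -
      note E = frechet_holomorphic_onD[OF holg that]
      show *: "(?d has_derivative (\<lambda>v. ?G n w v - ?G m w v)) (at w)"
        by (intro has_derivative_diff E)
      show "bounded_clinear (\<lambda>v. ?G n w v - ?G m w v)"
        using has_derivative_bounded_linear[OF *] E(2)
        by (simp add: bounded_clinear_def scaleC_complex_def right_diff_distrib)
    qed
    have "cmod (frechet_derivative ?d (at x) v) \<le> 2 * (B * t n + B * t m) / \<rho> * norm v"
    proof (rule norm_frechet_derivative_le[OF _ \<rho>])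
      show "frechet_holomorphic_on ?d (ball x \<rho>)"
        by (rule frechet_holomorphic_onI[OF hd bc]) (use in2[OF x] in auto)
      show "cmod (g n w - g m w) \<le> B * t n + B * t m" if "w \<in> ball x \<rho>" for w
        using close[OF in2[OF x that], of n] close[OF in2[OF x that], of m]
          norm_triangle_ineq4[of "g n w - ?D w h" "g m w - ?D w h"] by simp
    qed
    moreover have "frechet_derivative ?d (at x) = (\<lambda>v. ?G n x v - ?G m x v)"
      using frechet_derivative_at[OF hd[OF self2[OF x]]] by simp
    ultimately show ?thesis by (simp add: K_def field_simps add_divide_distrib)
  qed
  have "\<exists>l. (\<lambda>n. ?G n x v) \<longlonglongrightarrow> l \<and> (\<forall>n. cmod (?G n x v - l) \<le> K * norm v * t n)"
    if "x \<in> ?S" for x v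
    by (rule convergent_of_vanishing_bound[OF t_lim cauchy[OF that, of _ v]]) blast
  then obtain G where G_lim: "\<And>x v. x \<in> ?S \<Longrightarrow> (\<lambda>n. ?G n x v) \<longlonglongrightarrow> G x v"
    and G_bound: "\<And>x v n. x \<in> ?S \<Longrightarrow> cmod (?G n x v - G x v) \<le> K * norm v * t n"
    by metis
  have g_lim: "(\<lambda>n. g n x) \<longlonglongrightarrow> ?D x h" if "x \<in> ?S" for x
    using close[OF self2[OF that]]
    by (intro LIM_zero_cancel[OF Lim_null_comparison[OF _ t_lim]] always_eventually) blast
  have x0: "x0 \<in> ?S" using \<rho> by simp
  \<comment> \<open>The derivatives converge uniformly in operator norm on a convex set and the
    functions converge at \<open>x0\<close>, so the limit may be differentiated termwise.\<close>
  have "\<exists>l. \<forall>x\<in>?S. (\<lambda>n. g n x) \<longlonglongrightarrow> l x \<and> (l has_derivative G x) (at x within ?S)"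
  proof (rule has_derivative_sequence[where f = g and f' = ?G and g' = G,
        OF convex_ball _ _ x0 g_lim[OF x0]])
    show "(g n has_derivative ?G n x) (at x within ?S)" if "x \<in> ?S" for n x
      using DG(1)[OF that] has_derivative_at_withinI by blast
    fix e :: real assume "0 < e"
    then have "\<forall>\<^sub>F n in sequentially. K * t n < e"
      using order_tendstoD(2)[OF t_lim] by simp
    then show "\<forall>\<^sub>F n in sequentially. \<forall>x\<in>?S. \<forall>v. cmod (?G n x v - G x v) \<le> e * norm v"
    proof eventually_elim
      case (elim n)
      show ?case
      proof (intro ballI allI)
        fix x v assume "x \<in> ?S"
        then have "cmod (?G n x v - G x v) \<le> K * t n * norm v"
          using G_bound[of x n v] by (simp add: algebra_simps)
        also have "\<dots> \<le> e * norm v" using elim by (simp add: mult_right_mono)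
        finally show "cmod (?G n x v - G x v) \<le> e * norm v" .
      qed
    qed
  qed
  then obtain l where l: "\<And>x. x \<in> ?S \<Longrightarrow> (\<lambda>n. g n x) \<longlonglongrightarrow> l x"
    and dl: "\<And>x. x \<in> ?S \<Longrightarrow> (l has_derivative G x) (at x within ?S)" by blast
  have leq: "l x = ?D x h" if "x \<in> ?S" for x
    using LIMSEQ_unique l g_lim that by blast
  have "(l has_derivative G x0) (at x0)"
    using dl[OF x0] at_within_open[OF x0 open_ball] by simp
  then have D: "((\<lambda>w. ?D w h) has_derivative G x0) (at x0)"
    by (rule has_derivative_transform_within_open[OF _ open_ball x0 leq])
  \<comment> \<open>Termwise differentiation speaks of real derivatives; complex homogeneity is
    passed to the limit separately.\<close>
  have "G x0 (c *\<^sub>C v) = c * G x0 v" for c v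
  proof (rule LIMSEQ_unique[OF G_lim[OF x0]])
    have "?G n x0 (c *\<^sub>C v) = c * ?G n x0 v" for n
      by (rule bounded_clinear_scaleC_complex[OF DG(2)[OF x0]])
    then show "(\<lambda>n. ?G n x0 (c *\<^sub>C v)) \<longlonglongrightarrow> c * G x0 v"
      using tendsto_mult_left[OF G_lim[OF x0]] by simp
  qed
  then have "bounded_clinear (G x0)"
    using has_derivative_bounded_linear[OF D] by (simp add: bounded_clinear_def scaleC_complex_def)
  with D show "\<exists>L. bounded_clinear L \<and> ((\<lambda>w. ?D w h) has_derivative L) (at x0)" by blast
qed

lemma frechet_holomorphic_on_frechet_D:
  fixes f :: "'a::complex_normed_vector \<Rightarrow> complex"
  assumes "frechet_holomorphic_on f U" and "open U"
  shows "frechet_holomorphic_on (frechet_D f hs) U"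
  by (induction hs) (simp_all add: assms frechet_holomorphic_on_derivative)

section \<open>Higher derivatives along lines and of \<open>z f(z)\<close>\<close>

text \<open>Repeated differentiation in direction \<open>u\<close> is differentiation of the slice,
  and homogeneity extracts one factor \<open>c\<close> per direction. The scalar is kept apart from
  \<open>u\<close> so that a vector can be inserted as its norm times a unit vector.\<close>

lemma frechet_D_along_line:
  fixes f :: "'a::complex_normed_vector \<Rightarrow> complex"
  assumes holf: "frechet_holomorphic_on f U" and "open U" and "\<zeta> *\<^sub>C u \<in> U"
  shows "frechet_D f (replicate n (c *\<^sub>C u)) (\<zeta> *\<^sub>C u) = c ^ n * (deriv ^^ n) (\<lambda>\<zeta>. f (\<zeta> *\<^sub>C u)) \<zeta>"
  using assms(3)
proof (induction n arbitrary: \<zeta>)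
  case (Suc n)
  let ?g = "frechet_D f (replicate n (c *\<^sub>C u))"
  let ?L = "frechet_derivative ?g (at (\<zeta> *\<^sub>C u))"
  let ?\<phi> = "\<lambda>\<zeta>. f (\<zeta> *\<^sub>C u)"
  have holg: "frechet_holomorphic_on ?g U"
    by (rule frechet_holomorphic_on_frechet_D[OF holf \<open>open U\<close>])
  note D = frechet_holomorphic_onD[OF holg Suc.prems]
  have "((\<lambda>\<zeta>. ?g (\<zeta> *\<^sub>C u)) has_field_derivative ?L u) (at \<zeta>)"
    using has_field_derivative_along_line[of ?g ?L 0 \<zeta> u] D by simp
  define S where "S = (\<lambda>\<zeta>. \<zeta> *\<^sub>C u) -` U"
  have "continuous_on UNIV (\<lambda>\<zeta>. \<zeta> *\<^sub>C u)"
    by (intro linear_continuous_on scaleC.bounded_linear_left)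
  then have S: "open S"
    unfolding S_def by (rule open_vimage[OF \<open>open U\<close>])
  have "\<zeta> \<in> S" using Suc.prems by (simp add: S_def)
  have hol: "?\<phi> holomorphic_on S"
    using holomorphic_on_along_line[OF holf _ S, of 0 u] by (simp add: S_def)
  then have "(deriv ^^ n) ?\<phi> field_differentiable at \<zeta>"
    using S \<open>\<zeta> \<in> S\<close> holomorphic_higher_deriv holomorphic_on_imp_differentiable_at by blast
  then have "((\<lambda>\<zeta>. c ^ n * (deriv ^^ n) ?\<phi> \<zeta>) has_field_derivative c ^ n * (deriv ^^ Suc n) ?\<phi> \<zeta>) (at \<zeta>)"
    by (intro DERIV_cmult) (simp add: field_differentiable_derivI)
  then have "((\<lambda>\<zeta>. ?g (\<zeta> *\<^sub>C u)) has_field_derivative c ^ n * (deriv ^^ Suc n) ?\<phi> \<zeta>) (at \<zeta>)"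
    by (rule has_field_derivative_transform_within_open[OF _ S \<open>\<zeta> \<in> S\<close>]) (simp add: S_def Suc.IH)
  then have "?L u = c ^ n * (deriv ^^ Suc n) ?\<phi> \<zeta>"
    using \<open>((\<lambda>\<zeta>. ?g (\<zeta> *\<^sub>C u)) has_field_derivative ?L u) (at \<zeta>)\<close> DERIV_unique by blast
  then show ?case
    using bounded_clinear_scaleC_complex[OF D(2), of c u] by (simp add: mult.assoc)
qed simp

text \<open>Leibniz rule for a product with the identity, whose second derivative vanishes: at most
  one direction can fall on the factor \<open>w\<close>, and the sum runs over its position
  \<open>i\<close>. At \<open>w = 0\<close> only the sum survives.\<close>

lemma frechet_D_scaleC_identity:
  fixes f :: "'a::complex_normed_vector \<Rightarrow> complex"
  assumes holf: "frechet_holomorphic_on f U" and "open U"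
    and F: "\<And>w. w \<in> U \<Longrightarrow> F w = f w *\<^sub>C w" and "w \<in> U"
  shows "frechet_D F hs w = frechet_D f hs w *\<^sub>C w
    + (\<Sum>i<length hs. frechet_D f (take i hs @ drop (Suc i) hs) w *\<^sub>C (hs ! i))"
  using \<open>w \<in> U\<close>
proof (induction hs arbitrary: w)
  case (Cons h hs)
  let ?del = "\<lambda>i. take i hs @ drop (Suc i) hs"
  let ?D = "\<lambda>gs. frechet_derivative (frechet_D f gs) (at w)"
  have D: "(frechet_D f gs has_derivative ?D gs) (at w)" for gs
    using frechet_holomorphic_onD(1)[OF frechet_holomorphic_on_frechet_D[OF holf \<open>open U\<close>] Cons.prems] .
  have "((\<lambda>w. frechet_D f hs w *\<^sub>C w + (\<Sum>i<length hs. frechet_D f (?del i) w *\<^sub>C (hs ! i)))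
      has_derivative (\<lambda>v. (frechet_D f hs w *\<^sub>C v + ?D hs v *\<^sub>C w)
        + (\<Sum>i<length hs. ?D (?del i) v *\<^sub>C (hs ! i)))) (at w)"
    by (intro has_derivative_add has_derivative_sum scaleC.FDERIV[OF D has_derivative_ident]
        bounded_linear.has_derivative[OF scaleC.bounded_linear_left D])
  then have "(frechet_D F hs has_derivative (\<lambda>v. (frechet_D f hs w *\<^sub>C v + ?D hs v *\<^sub>C w)
        + (\<Sum>i<length hs. ?D (?del i) v *\<^sub>C (hs ! i)))) (at w)"
    by (rule has_derivative_transform_within_open[OF _ \<open>open U\<close> Cons.prems])
      (rule Cons.IH[symmetric])
  note eq = frechet_derivative_at[OF this]
  have "frechet_D F (h # hs) w = (frechet_D f hs w *\<^sub>C h + ?D hs h *\<^sub>C w)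
        + (\<Sum>i<length hs. ?D (?del i) h *\<^sub>C (hs ! i))"
    by (simp add: eq[symmetric])
  \<comment> \<open>Differentiating the factor \<open>w\<close> in direction \<open>h\<close>
    creates the summand of index 0; the old summands shift by one.\<close>
  then show ?case
    by (simp add: sum.lessThan_Suc_shift del: sum.lessThan_Suc)
qed (simp add: F)

text \<open>By linearity of \<open>l\<close>, each direction contributes a factor \<open>l h\<close>
  and one derivative of \<open>\<psi>\<close>. Arbitrary lists are treated because the order of a
  zero quantifies over all of them.\<close>

lemma frechet_D_compose_functional:
  fixes l :: "'a::complex_normed_vector \<Rightarrow> complex"
  assumes l: "bounded_clinear l" and \<psi>: "\<psi> holomorphic_on S" and "open S" and "l w \<in> S"
  shows "frechet_D (\<lambda>w. \<psi> (l w)) hs w = prod_list (map l hs) * (deriv ^^ length hs) \<psi> (l w)"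
  using \<open>l w \<in> S\<close>
proof (induction hs arbitrary: w)
  case (Cons h hs)
  let ?n = "length hs"
  have bl: "bounded_linear l" by (rule bounded_clinear_imp_bounded_linear[OF l])
  have "((deriv ^^ ?n) \<psi> has_field_derivative (deriv ^^ Suc ?n) \<psi> (l w)) (at (l w))"
    using holomorphic_derivI[OF holomorphic_higher_deriv[OF \<psi> \<open>open S\<close>] \<open>open S\<close> Cons.prems] by simp
  then have "((deriv ^^ ?n) \<psi> has_derivative (*) ((deriv ^^ Suc ?n) \<psi> (l w))) (at (l w))"
    by (simp add: has_field_derivative_def)
  from has_derivative_compose[OF bounded_linear.has_derivative[OF bl has_derivative_ident] this]
  have "((\<lambda>w. prod_list (map l hs) * (deriv ^^ ?n) \<psi> (l w)) has_derivative
      (\<lambda>v. prod_list (map l hs) * ((deriv ^^ Suc ?n) \<psi> (l w) * l v))) (at w)"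
    by (rule has_derivative_mult_right)
  then have "(frechet_D (\<lambda>w. \<psi> (l w)) hs has_derivative
      (\<lambda>v. prod_list (map l hs) * ((deriv ^^ Suc ?n) \<psi> (l w) * l v))) (at w)"
  proof (rule has_derivative_transform_within_open)
    show "open (l -` S)"
      by (rule open_vimage[OF \<open>open S\<close> linear_continuous_on[OF bl]])
  qed (use Cons in simp_all)
  note eq = frechet_derivative_at[OF this]
  show ?case by (simp add: eq[symmetric] mult_ac)
qed simp

section \<open>Coefficient estimates in the unit disc\<close>

text \<open>The Fourier coefficient of index \<open>n\<close> of \<open>cnj p\<close> on a circle vanishes, so \<open>p\<close> may be
  replaced by \<open>2 * Re p\<close> in Cauchy's formula.\<close>

lemma caratheodory_coefficient_bound:
  fixes p :: "complex \<Rightarrow> complex"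
  assumes hol: "p holomorphic_on ball 0 1" and pos: "\<And>\<zeta>. \<zeta> \<in> ball 0 1 \<Longrightarrow> 0 < Re (p \<zeta>)"
    and p0: "p 0 = 1" and "n \<ge> 1"
  shows "cmod ((deriv ^^ n) p 0 / fact n) \<le> 2"
proof -
  let ?c = "\<lambda>n. (deriv ^^ n) p 0 / fact n"
  have bound: "cmod (?c n) * r ^ n \<le> 2" if r: "0 < r" "r < 1" for r
  proof -
    define E where "E x = exp (2 * complex_of_real pi * \<i> * complex_of_real x)" for x
    have E: "E x \<noteq> 0" "cmod (E x) = 1" "cnj (E x) = inverse (E x)" for x
      by (simp_all add: E_def exp_cnj norm_exp_eq_Re flip: exp_minus)
    define P where "P x = p (of_real r * E x)" for x
    have sub: "cball 0 r \<subseteq> ball (0::complex) 1" using r by auto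
    have circ: "circlepath 0 r x = of_real r * E x" for x
      by (simp add: circlepath E_def)
    have pos': "0 < Re (P x)" for x
      unfolding P_def using r E by (intro pos) (simp add: norm_mult)
    have A: "((\<lambda>x. P x / E x ^ m) has_integral ?c m * r ^ m) {0..1}" for m
    proof -
      have "((\<lambda>u. p u / (u - 0) ^ Suc m) has_contour_integral (2 * pi * \<i>) / fact m * (deriv ^^ m) p 0)
          (circlepath 0 r)"
        by (rule Cauchy_has_contour_integral_higher_derivative_circlepath)
          (use r sub hol in \<open>auto intro: holomorphic_on_subset
            continuous_on_subset[OF holomorphic_on_imp_continuous_on]\<close>)
      then have "((\<lambda>x. p (circlepath 0 r x) / (circlepath 0 r x) ^ Suc m * (2 * pi * \<i> * r * E x))
          has_integral 2 * pi * \<i> * ?c m) {0..1}"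
        by (simp add: has_contour_integral vector_derivative_circlepath E_def)
      from has_integral_mult_right[OF this, of "r ^ m / (2 * pi * \<i>)"]
      have "((\<lambda>x. r ^ m / (2 * pi * \<i>) *
            (p (circlepath 0 r x) / (circlepath 0 r x) ^ Suc m * (2 * pi * \<i> * r * E x)))
          has_integral ?c m * r ^ m) {0..1}"
        by (simp add: mult.commute)
      moreover have "r ^ m / (2 * pi * \<i>) *
            (p (circlepath 0 r x) / (circlepath 0 r x) ^ Suc m * (2 * pi * \<i> * r * E x)) = P x / E x ^ m" for x
        using r E(1)[of x] by (simp add: circ P_def field_simps)
      ultimately show ?thesis by simp
    qed
    \<comment> \<open>Cauchy's theorem for \<open>p u * u ^ (n - 1)\<close>; the missing factor
      \<open>u\<close> comes from the differential on the circle, and \<open>n \<ge> 1\<close> makes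
      the predecessor genuine.\<close>
    have B: "((\<lambda>x. P x * E x ^ n) has_integral 0) {0..1}"
    proof -
      have "((\<lambda>u. p u * u ^ (n - 1)) has_contour_integral 0) (circlepath 0 r)"
        by (rule Cauchy_theorem_disc_simple[of _ 0 1])
          (use r hol in \<open>auto intro!: holomorphic_intros\<close>)
      then have "((\<lambda>x. p (circlepath 0 r x) * circlepath 0 r x ^ (n - 1) * (2 * pi * \<i> * r * E x))
          has_integral 0) {0..1}"
        by (simp add: has_contour_integral vector_derivative_circlepath E_def)
      from has_integral_mult_right[OF this, of "1 / (2 * pi * \<i> * r ^ n)"]
      have "((\<lambda>x. 1 / (2 * pi * \<i> * r ^ n) *
          (p (circlepath 0 r x) * circlepath 0 r x ^ (n - 1) * (2 * pi * \<i> * r * E x)))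
          has_integral 0) {0..1}"
        by simp
      moreover have "1 / (2 * pi * \<i> * r ^ n) *
          (p (circlepath 0 r x) * circlepath 0 r x ^ (n - 1) * (2 * pi * \<i> * r * E x)) = P x * E x ^ n" for x
        using r E(1)[of x] \<open>n \<ge> 1\<close>
        by (cases n) (simp_all add: circ P_def power_mult_distrib field_simps)
      ultimately show ?thesis by simp
    qed
    \<comment> \<open>\<open>E x\<close> is unimodular, so conjugation turns \<open>E x ^ n\<close>
      into its reciprocal and the vanishing integral can be added to \<open>A\<close>.\<close>
    have "((cnj \<circ> (\<lambda>x. P x * E x ^ n)) has_integral cnj 0) {0..1}"
      using B by (simp only: has_integral_cnj)
    from has_integral_add[OF A[of n] this]
    have "((\<lambda>x. P x / E x ^ n + cnj (P x) / E x ^ n) has_integral ?c n * r ^ n) {0..1}"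
      by (simp add: o_def E power_inverse divide_inverse)
    moreover have "P x / E x ^ n + cnj (P x) / E x ^ n = of_real (2 * Re (P x)) / E x ^ n" for x
      by (simp add: complex_add_cnj flip: add_divide_distrib)
    ultimately have C: "((\<lambda>x. of_real (2 * Re (P x)) / E x ^ n) has_integral ?c n * r ^ n) {0..1}"
      by simp
    \<comment> \<open>The case \<open>m = 0\<close> of \<open>A\<close>: the mean of
      \<open>Re p\<close> over the circle is \<open>Re (p 0) = 1\<close>. Since \<open>Re p\<close>
      is positive, it also is the mean of the modulus \<open>|Re p|\<close>.\<close>
    have D: "((\<lambda>x. 2 * Re (P x)) has_integral 2) {0..1}"
      using has_integral_mult_right[OF has_integral_linear[OF A[of 0] bounded_linear_Re], of 2]
      by (simp add: o_def p0)
    have "cmod (integral {0..1} (\<lambda>x. of_real (2 * Re (P x)) / E x ^ n)) \<le> integral {0..1} (\<lambda>x. 2 * Re (P x))"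
    proof (rule integral_norm_bound_integral)
      show "cmod (of_real (2 * Re (P x)) / E x ^ n) \<le> 2 * Re (P x)" for x
        using pos'[of x] E(2)[of x] by (simp add: norm_divide norm_power norm_mult)
    qed (use C D in \<open>auto simp: integrable_on_def\<close>)
    then show ?thesis
      unfolding integral_unique[OF C] integral_unique[OF D] using r by (simp only: norm_mult norm_power norm_of_real) simp
  qed
  \<comment> \<open>The factor \<open>r ^ n\<close> left by the circle of radius \<open>r\<close>
    disappears as \<open>r\<close> tends to 1.\<close>
  have "((\<lambda>r. cmod (?c n) * r ^ n) \<longlongrightarrow> cmod (?c n) * 1 ^ n) (at_left 1)"
    by (intro tendsto_intros)
  moreover have "eventually (\<lambda>r. cmod (?c n) * r ^ n \<le> 2) (at_left 1)"
    using eventually_at_left_real[of 0 1] by (rule eventually_mono) (use bound in auto)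
  ultimately show ?thesis
    using tendsto_upperbound by fastforce
qed

section \<open>Power series comparison in the equation for the logarithmic derivative\<close>

lemma fps_X_mult_deriv_nth:
  fixes F Q :: "'b::comm_ring_1 fps"
  assumes "fps_X * fps_deriv F = F * Q"
  shows "of_nat n * fps_nth F n = (\<Sum>i=0..n. fps_nth F i * fps_nth Q (n - i))"
proof -
  have "of_nat n * fps_nth F n = fps_nth (fps_X * fps_deriv F) n"
    by (cases n) simp_all
  then show ?thesis
    by (simp add: assms fps_mult_nth)
qed

text \<open>As \<open>n < k\<close>, only the term \<open>i = 0\<close> of the Cauchy product
  survives; the left side vanishes through the factor \<open>n\<close> when \<open>n = 0\<close> and
  through \<open>F\<close> otherwise.\<close>

lemma log_derivative_coeffs_vanish:
  fixes F Q :: "complex fps"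
  assumes eq: "fps_X * fps_deriv F = F * Q" and F0: "fps_nth F 0 = 1"
    and F: "\<And>j. 0 < j \<Longrightarrow> j < k \<Longrightarrow> fps_nth F j = 0" and "n < k"
  shows "fps_nth Q n = 0"
proof -
  have "of_nat n * fps_nth F n = (\<Sum>i\<in>{0}. fps_nth F i * fps_nth Q (n - i))"
    unfolding fps_X_mult_deriv_nth[OF eq] using \<open>n < k\<close> F by (intro sum.mono_neutral_right) auto
  moreover have "of_nat n * fps_nth F n = 0"
    using F[of n] \<open>n < k\<close> by (cases "n = 0") auto
  ultimately show ?thesis using F0 by simp
qed

text \<open>The converse direction, needed for the extremal function: there \<open>Q\<close> is
  explicit and the gap in \<open>F\<close> has to be derived.\<close>

lemma coeffs_vanish_of_log_derivative:
  fixes F Q :: "complex fps"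
  assumes eq: "fps_X * fps_deriv F = F * Q"
    and Q: "\<And>j. j < k \<Longrightarrow> fps_nth Q j = 0" and "0 < n" "n < k"
  shows "fps_nth F n = 0"
proof -
  have "of_nat n * fps_nth F n = 0"
    unfolding fps_X_mult_deriv_nth[OF eq] using \<open>n < k\<close> Q by (intro sum.neutral) auto
  then show ?thesis using \<open>0 < n\<close> by simp
qed

text \<open>Apart from the constant term of \<open>F\<close>, both series start at index
  \<open>k\<close>. In the Cauchy product at \<open>2 * k\<close>, an index strictly between 0 and
  \<open>k\<close> kills the factor from \<open>F\<close>, and one above \<open>k\<close> leaves
  less than \<open>k\<close> for \<open>Q\<close>; only 0 and \<open>k\<close> remain.\<close>

lemma log_derivative_coeffs:
  fixes F Q :: "complex fps"
  assumes eq: "fps_X * fps_deriv F = F * Q" and F0: "fps_nth F 0 = 1" and "k \<ge> 1"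
    and F: "\<And>j. 0 < j \<Longrightarrow> j < k \<Longrightarrow> fps_nth F j = 0"
    and Q: "\<And>j. j < k \<Longrightarrow> fps_nth Q j = 0"
  shows "of_nat k * fps_nth F k = fps_nth Q k"
    and "2 * of_nat k * fps_nth F (2 * k) = fps_nth Q (2 * k) + fps_nth F k * fps_nth Q k"
proof -
  have "of_nat k * fps_nth F k = (\<Sum>i\<in>{0}. fps_nth F i * fps_nth Q (k - i))"
    unfolding fps_X_mult_deriv_nth[OF eq]
  proof (intro sum.mono_neutral_right ballI)
    fix i assume i: "i \<in> {0..k} - {0}"
    show "fps_nth F i * fps_nth Q (k - i) = 0"
      using i F[of i] Q[of "k - i"] \<open>k \<ge> 1\<close> by (cases "i < k") auto
  qed auto
  then show "of_nat k * fps_nth F k = fps_nth Q k" using F0 by simp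
  have "of_nat (2 * k) * fps_nth F (2 * k) = (\<Sum>i\<in>{0, k}. fps_nth F i * fps_nth Q (2 * k - i))"
    unfolding fps_X_mult_deriv_nth[OF eq]
  proof (intro sum.mono_neutral_right ballI)
    fix i assume i: "i \<in> {0..2 * k} - {0, k}"
    show "fps_nth F i * fps_nth Q (2 * k - i) = 0"
    proof (cases "i < k")
      case False
      then have "2 * k - i < k" using i by auto
      then show ?thesis using Q by simp
    qed (use i F[of i] in auto)
  qed auto
  then show "2 * of_nat k * fps_nth F (2 * k) = fps_nth Q (2 * k) + fps_nth F k * fps_nth Q k"
    using F0 \<open>k \<ge> 1\<close> by simp
qed

lemma holomorphic_has_fps_expansion:
  assumes "f holomorphic_on ball 0 1"
  shows "f has_fps_expansion fps_expansion f 0"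
  using assms by (intro analytic_at_imp_has_fps_expansion_0) (auto simp: analytic_at intro!: exI[of _ "ball 0 1"])

lemma log_derivative_fps_expansion:
  fixes \<phi> q :: "complex \<Rightarrow> complex"
  assumes "\<phi> holomorphic_on ball 0 1" and "q holomorphic_on ball 0 1"
    and eq: "\<And>\<zeta>. \<zeta> \<in> ball 0 1 \<Longrightarrow> \<zeta> * deriv \<phi> \<zeta> = \<phi> \<zeta> * q \<zeta>"
  shows "fps_X * fps_deriv (fps_expansion \<phi> 0) = fps_expansion \<phi> 0 * fps_expansion q 0"
proof (rule fps_expansion_unique_complex)
  note E = assms(1,2)[THEN holomorphic_has_fps_expansion]
  show "(\<lambda>\<zeta>. \<zeta> * deriv \<phi> \<zeta>) has_fps_expansion fps_X * fps_deriv (fps_expansion \<phi> 0)"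
    by (intro fps_expansion_intros E)
  have "(\<lambda>\<zeta>. \<phi> \<zeta> * q \<zeta>) has_fps_expansion fps_expansion \<phi> 0 * fps_expansion q 0"
    by (intro fps_expansion_intros E)
  moreover have "eventually (\<lambda>\<zeta>. \<phi> \<zeta> * q \<zeta> = \<zeta> * deriv \<phi> \<zeta>) (nhds 0)"
    unfolding eventually_nhds using eq by (intro exI[of _ "ball 0 1"]) auto
  ultimately show "(\<lambda>\<zeta>. \<zeta> * deriv \<phi> \<zeta>) has_fps_expansion fps_expansion \<phi> 0 * fps_expansion q 0"
    using has_fps_expansion_cong by metis
qed

lemma starlike_coefficient_bound:
  fixes \<phi> p :: "complex \<Rightarrow> complex"
  defines "a \<equiv> fps_nth (fps_expansion \<phi> 0)"
  assumes hol: "\<phi> holomorphic_on ball 0 1" "p holomorphic_on ball 0 1"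
    and eq: "\<And>\<zeta>. \<zeta> \<in> ball 0 1 \<Longrightarrow> \<zeta> * deriv \<phi> \<zeta> = \<phi> \<zeta> * (p \<zeta> - 1)"
    and pos: "\<And>\<zeta>. \<zeta> \<in> ball 0 1 \<Longrightarrow> 0 < Re (p \<zeta>)"
    and \<phi>0: "\<phi> 0 = 1" and "k \<ge> 1"
    and vanish: "\<And>j. 0 < j \<Longrightarrow> j < k \<Longrightarrow> a j = 0"
  shows "cmod ((a (2 * k))\<^sup>2 - (a k)\<^sup>2) \<le> (real k + 2)\<^sup>2 / real k ^ 4 + 4 / (real k)\<^sup>2"
proof -
  let ?F = "fps_expansion \<phi> 0" and ?Q = "fps_expansion (\<lambda>\<zeta>. p \<zeta> - 1) 0"
  have holq: "(\<lambda>\<zeta>. p \<zeta> - 1) holomorphic_on ball 0 1"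
    using hol(2) by (intro holomorphic_intros)
  have FQ: "fps_X * fps_deriv ?F = ?F * ?Q"
    by (rule log_derivative_fps_expansion[OF hol(1) holq eq])
  have F0: "fps_nth ?F 0 = 1" using \<phi>0 by (simp add: fps_expansion_def)
  have p0: "p 0 = 1" using eq[of 0] \<phi>0 by simp
  have Q: "fps_nth ?Q j = 0" if "j < k" for j
    by (rule log_derivative_coeffs_vanish[OF FQ F0 _ that]) (use vanish in \<open>simp add: a_def\<close>)
  note rel = log_derivative_coeffs[OF FQ F0 \<open>k \<ge> 1\<close> vanish[unfolded a_def] Q, folded a_def]
  have Q2: "cmod (fps_nth ?Q n) \<le> 2" if "n \<ge> 1" for n
  proof -
    \<comment> \<open>Subtracting 1 changes only the coefficient of index 0, so for
      \<open>n \<ge> 1\<close> Caratheodory's bound for \<open>p\<close> applies.\<close>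
    have "?Q = fps_expansion p 0 - 1"
      by (rule fps_expansion_unique_complex[OF holomorphic_has_fps_expansion[OF holq]])
        (intro fps_expansion_intros holomorphic_has_fps_expansion hol)
    then have "fps_nth ?Q n = (deriv ^^ n) p 0 / fact n"
      using that by (simp add: fps_expansion_def)
    then show ?thesis
      using caratheodory_coefficient_bound[OF hol(2) pos p0 that] by simp
  qed
  have k: "real k > 0" using \<open>k \<ge> 1\<close> by simp
  have "real k * cmod (a k) = cmod (fps_nth ?Q k)"
    by (simp add: rel(1)[symmetric] norm_mult)
  then have b: "cmod (a k) \<le> 2 / real k"
    using Q2[OF \<open>k \<ge> 1\<close>] k by (simp add: field_simps)
  have prod: "cmod (a k) * cmod (fps_nth ?Q k) \<le> 2 / real k * 2"
    using k by (intro mult_mono b Q2[OF \<open>k \<ge> 1\<close>]) auto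
  have "2 * real k * cmod (a (2 * k)) = cmod (fps_nth ?Q (2 * k) + a k * fps_nth ?Q k)"
    by (simp add: rel(2)[symmetric] norm_mult)
  also have "\<dots> \<le> 2 + 2 / real k * 2"
    using Q2[of "2 * k"] prod \<open>k \<ge> 1\<close>
    by (intro order.trans[OF norm_triangle_ineq] add_mono) (auto simp: norm_mult)
  finally have c: "cmod (a (2 * k)) \<le> (real k + 2) / (real k)\<^sup>2"
    using k by (simp add: field_simps power2_eq_square)
  have "cmod ((a (2 * k))\<^sup>2 - (a k)\<^sup>2) \<le> (cmod (a (2 * k)))\<^sup>2 + (cmod (a k))\<^sup>2"
    by (metis norm_triangle_ineq4 norm_power)
  also have "\<dots> \<le> ((real k + 2) / (real k)\<^sup>2)\<^sup>2 + (2 / real k)\<^sup>2"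
    using b c by (intro add_mono power_mono) auto
  also have "\<dots> = (real k + 2)\<^sup>2 / real k ^ 4 + 4 / (real k)\<^sup>2"
    by (simp add: power_divide)
  finally show ?thesis .
qed

section \<open>Support functionals\<close>

definition sublinear :: "('a::real_vector \<Rightarrow> real) \<Rightarrow> bool" where
  "sublinear q \<longleftrightarrow> (\<forall>x y. q (x + y) \<le> q x + q y) \<and> (\<forall>c>0. \<forall>x. q (c *\<^sub>R x) \<le> c * q x)"

lemma sublinear_add: "sublinear q \<Longrightarrow> q (x + y) \<le> q x + q y"
  by (simp add: sublinear_def)

text \<open>The definition asks only for an inequality in positive scalars, the form that infima
  inherit. Applying it to \<open>1 / c\<close> gives the reverse one, and the scalar 1/2 together
  with subadditivity settles \<open>q 0 = 0\<close>.\<close>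

lemma sublinear_scaleR:
  assumes "sublinear q" and "0 \<le> c"
  shows "q (c *\<^sub>R x) = c * q x"
proof (cases "c = 0")
  case True
  have "q 0 \<le> (1 / 2) * q 0"
    using assms(1)[unfolded sublinear_def, THEN conjunct2, rule_format, of "1 / 2" 0] by simp
  moreover have "q (0 + 0) \<le> q 0 + q 0"
    using sublinear_add[OF assms(1)] by blast
  ultimately show ?thesis using True by simp
next
  case False
  then have "0 < c" using assms(2) by simp
  have hom: "q (d *\<^sub>R y) \<le> d * q y" if "0 < d" for d y
    using assms(1) that unfolding sublinear_def by blast
  have "q ((1 / c) *\<^sub>R c *\<^sub>R x) \<le> (1 / c) * q (c *\<^sub>R x)"
    using \<open>0 < c\<close> by (intro hom) simp
  then have "c * q x \<le> q (c *\<^sub>R x)"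
    using \<open>0 < c\<close> by (simp add: field_simps)
  moreover have "q (c *\<^sub>R x) \<le> c * q x" by (rule hom[OF \<open>0 < c\<close>])
  ultimately show ?thesis by simp
qed

lemma sublinear_zero: "sublinear q \<Longrightarrow> q 0 = 0"
  using sublinear_scaleR[of q 0 0] by simp

lemma sublinear_minus_le: "sublinear q \<Longrightarrow> - q (- x) \<le> q x"
  using sublinear_add[of q x "- x"] sublinear_zero[of q] by simp

text \<open>Serves two families: chains of functionals, where the smaller member handles both
  summands, and translates with parameter \<open>t \<ge> 0\<close>, where the parameters are added
  or scaled along with the vectors.\<close>

lemma sublinear_INF:
  fixes q :: "'i \<Rightarrow> 'a::real_vector \<Rightarrow> real"
  assumes "I \<noteq> {}" and bdd: "\<And>x. bdd_below ((\<lambda>i. q i x) ` I)"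
    and add: "\<And>i j x y. i \<in> I \<Longrightarrow> j \<in> I \<Longrightarrow> \<exists>k\<in>I. q k (x + y) \<le> q i x + q j y"
    and scale: "\<And>i c x. i \<in> I \<Longrightarrow> 0 < c \<Longrightarrow> \<exists>k\<in>I. q k (c *\<^sub>R x) \<le> c * q i x"
  shows "sublinear (\<lambda>x. INF i\<in>I. q i x)"
  unfolding sublinear_def
proof (intro conjI allI impI)
  let ?u = "\<lambda>x. INF i\<in>I. q i x"
  have lower: "?u x \<le> q i x" if "i \<in> I" for i x
    using that bdd by (intro cINF_lower)
  fix x y
  have "?u (x + y) \<le> q i x + q j y" if "i \<in> I" "j \<in> I" for i j
    using add[OF that] lower order.trans by meson
  then have "?u (x + y) - q j y \<le> ?u x" if "j \<in> I" for j
    using that \<open>I \<noteq> {}\<close> by (intro cINF_greatest) (auto simp: algebra_simps)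
  then have "?u (x + y) - ?u x \<le> ?u y"
    using \<open>I \<noteq> {}\<close> by (intro cINF_greatest) (auto simp: algebra_simps)
  then show "?u (x + y) \<le> ?u x + ?u y" by simp
  fix c :: real assume "0 < c"
  have "?u (c *\<^sub>R x) \<le> c * q i x" if "i \<in> I" for i
    using scale[OF that \<open>0 < c\<close>] lower order.trans by meson
  then have "?u (c *\<^sub>R x) / c \<le> ?u x"
    using \<open>I \<noteq> {}\<close> \<open>0 < c\<close> by (intro cINF_greatest) (auto simp: field_simps)
  then show "?u (c *\<^sub>R x) \<le> c * ?u x" using \<open>0 < c\<close> by (simp add: field_simps)
qed

text \<open>Zorn's lemma for the functionals below \<open>p\<close>. The pointwise infimum over a
  nonempty chain is finite because every member is at least \<open>- p (- x)\<close> at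
  \<open>x\<close>.\<close>

lemma sublinear_minimal:
  fixes p :: "'a::real_vector \<Rightarrow> real"
  assumes "sublinear p"
  obtains q where "sublinear q" and "q \<le> p" and "\<And>q'. sublinear q' \<Longrightarrow> q' \<le> q \<Longrightarrow> q' = q"
proof -
  define A where "A = {q. sublinear q \<and> q \<le> p}"
  \<comment> \<open>The order is reversed, so that Zorn's maximal element is a minimal
    functional.\<close>
  define P where "P = (\<lambda>(a :: 'a \<Rightarrow> real) b. b \<le> a)"
  have "\<exists>m\<in>A. \<forall>a\<in>A. P m a \<longrightarrow> a = m"
  proof (rule predicate_Zorn)
    show "partial_order_on A (relation_of P A)"
      by (rule partial_order_on_relation_ofI) (auto simp: P_def)
  next
    fix C assume "C \<in> Chains (relation_of P A)"
    then have C: "C \<subseteq> A" "\<And>a b. a \<in> C \<Longrightarrow> b \<in> C \<Longrightarrow> a \<le> b \<or> b \<le> a"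
      unfolding Chains_def relation_of_def P_def by auto
    show "\<exists>u\<in>A. \<forall>a\<in>C. P a u"
    proof (cases "C = {}")
      case True
      then show ?thesis using assms by (auto simp: A_def)
    next
      case False
      define u where "u x = (INF q\<in>C. q x)" for x
      have bdd: "bdd_below ((\<lambda>q. q x) ` C)" for x
      proof (rule bdd_belowI2)
        fix q assume "q \<in> C"
        then have "sublinear q" "q (- x) \<le> p (- x)"
          using C(1) by (auto simp: A_def le_fun_def)
        then show "- p (- x) \<le> q x" using sublinear_minus_le[of q x] by simp
      qed
      have le: "u \<le> q" if "q \<in> C" for q
        unfolding u_def le_fun_def using that bdd by (auto intro: cINF_lower)
      have "sublinear u"
        unfolding u_def
      proof (rule sublinear_INF[OF False bdd])
        fix a b x y assume ab: "a \<in> C" "b \<in> C"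
        then have sl: "sublinear a" "sublinear b" using C(1) by (auto simp: A_def)
        from C(2)[OF ab] show "\<exists>q\<in>C. q (x + y) \<le> a x + b y"
        proof
          assume "a \<le> b"
          then show ?thesis
            using ab sublinear_add[OF sl(1), of x y] le_funD[of a b y] by (intro bexI[of _ a]) auto
        next
          assume "b \<le> a"
          then show ?thesis
            using ab sublinear_add[OF sl(2), of x y] le_funD[of b a x] by (intro bexI[of _ b]) auto
        qed
      next
        fix a x and c :: real assume "a \<in> C" "0 < c"
        then show "\<exists>q\<in>C. q (c *\<^sub>R x) \<le> c * a x"
          using C(1) by (auto simp: A_def sublinear_def intro!: bexI[of _ a])
      qed
      moreover obtain a where "a \<in> C" using False by blast
      ultimately have "u \<in> A"
        using le[OF \<open>a \<in> C\<close>] C(1) order.trans by (auto simp: A_def)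
      then show ?thesis using le by (auto simp: P_def)
    qed
  qed
  then show thesis using that unfolding A_def P_def by (auto intro: order.trans)
qed

text \<open>The witness is an infimum over \<open>t \<ge> 0\<close>: \<open>t = 0\<close> puts it
  below \<open>q\<close>, \<open>t = 1\<close> gives the last inequality. For a minimal
  \<open>q\<close> it equals \<open>q\<close>, whence \<open>q x + q y \<le> q (x + y)\<close>, that
  is, additivity.\<close>

lemma sublinear_translate:
  fixes q :: "'a::real_vector \<Rightarrow> real" and y :: 'a
  assumes q: "sublinear q"
  obtains q' where "sublinear q'" and "q' \<le> q" and "\<And>x. q' x \<le> q (x + y) - q y"
proof
  let ?q = "\<lambda>t x. q (x + t *\<^sub>R y) - t * q y"
  let ?q' = "\<lambda>x. INF t\<in>{0..}. ?q t x"
  have bdd: "bdd_below ((\<lambda>t. ?q t x) ` {0..})" for x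
  proof (rule bdd_belowI2)
    fix t :: real assume "t \<in> {0..}"
    then have "t * q y \<le> q (x + t *\<^sub>R y) + q (- x)"
      using sublinear_add[OF q, of "x + t *\<^sub>R y" "- x"] sublinear_scaleR[OF q, of t y] by simp
    then show "- q (- x) \<le> ?q t x" by simp
  qed
  show "sublinear ?q'"
  proof (rule sublinear_INF[OF _ bdd])
    fix s t :: real and x z assume "s \<in> {0..}" "t \<in> {0..}"
    then show "\<exists>r\<in>{0..}. ?q r (x + z) \<le> ?q s x + ?q t z"
      using sublinear_add[OF q, of "x + s *\<^sub>R y" "z + t *\<^sub>R y"]
      by (intro bexI[of _ "s + t"]) (auto simp: algebra_simps)
  next
    fix t c :: real and x assume "t \<in> {0..}" "0 < c"
    then show "\<exists>r\<in>{0..}. ?q r (c *\<^sub>R x) \<le> c * ?q t x"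
      using sublinear_scaleR[OF q, of c "x + t *\<^sub>R y"]
      by (intro bexI[of _ "c * t"]) (auto simp: algebra_simps)
  qed simp
  have lower: "?q' x \<le> ?q t x" if "0 \<le> t" for t x
    using that bdd by (intro cINF_lower) auto
  show "?q' \<le> q" using lower[of 0] by (simp add: le_fun_def)
  show "?q' x \<le> q (x + y) - q y" for x using lower[of 1 x] by simp
qed

text \<open>Minimal sublinear functionals are linear. Starting from a translate of the norm by
  \<open>z\<close> forces the value at \<open>z\<close>, because everything below that translate is
  at most \<open>- norm z\<close> at \<open>- z\<close>.\<close>

lemma exists_real_support_functional:
  fixes z :: "'a::real_normed_vector"
  obtains l :: "'a \<Rightarrow> real" where "linear l" and "\<And>x. l x \<le> norm x" and "l z = norm z"
proof -
  have "sublinear (norm :: 'a \<Rightarrow> real)"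
    by (simp add: sublinear_def norm_triangle_ineq)
  then obtain p :: "'a \<Rightarrow> real" where p: "sublinear p" "p \<le> norm" "\<And>x. p x \<le> norm (x + z) - norm z"
    using sublinear_translate by metis
  obtain l where l: "sublinear l" "l \<le> p" and minimal: "\<And>q. sublinear q \<Longrightarrow> q \<le> l \<Longrightarrow> q = l"
    using sublinear_minimal[OF p(1)] by metis
  have add: "l (x + y) = l x + l y" for x y
  proof -
    obtain q where "sublinear q" "q \<le> l" "\<And>x. q x \<le> l (x + y) - l y"
      using sublinear_translate[OF l(1)] by metis
    then have "l x \<le> l (x + y) - l y" using minimal by metis
    then show ?thesis using sublinear_add[OF l(1), of x y] by simp
  qed
  have minus: "l (- x) = - l x" for x
    using add[of x "- x"] sublinear_zero[OF l(1)] by simp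
  have scale: "l (c *\<^sub>R x) = c * l x" for c x
    using sublinear_scaleR[OF l(1), of c x] sublinear_scaleR[OF l(1), of "- c" x] minus[of "c *\<^sub>R x"]
    by (cases "0 \<le> c") auto
  have le: "l x \<le> norm x" for x
    using l(2) p(2) order.trans le_funD by metis
  have "l (- z) \<le> - norm z"
    using le_funD[OF l(2), of "- z"] p(3)[of "- z"] by simp
  then have "l z = norm z" using le[of z] minus[of z] by simp
  moreover have "linear l" using add scale by (intro linearI) auto
  ultimately show thesis using that le by blast
qed

text \<open>A complex functional is recovered from its real part \<open>l\<close> as \<open>l x - \<i> * l (\<i> x)\<close>.\<close>

lemma support_functionals_nonempty:
  fixes z :: "'a::complex_normed_vector"
  assumes "z \<noteq> 0"
  shows "support_functionals z \<noteq> {}"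
proof -
  obtain l :: "'a \<Rightarrow> real" where l: "linear l" "\<And>x. l x \<le> norm x" "l z = norm z"
    using exists_real_support_functional by blast
  note lin = linear_add[OF l(1)] linear_scale[OF l(1)]
  define L where "L x = Complex (l x) (- l (\<i> *\<^sub>C x))" for x
  have add: "L (x + y) = L x + L y" for x y
    by (simp add: L_def lin scaleC_add_right complex_eq_iff)
  have scaleR: "L (r *\<^sub>R x) = of_real r * L x" for r x
    by (simp add: L_def lin scaleC.scaleR_right complex_eq_iff)
  have scale_i: "L (\<i> *\<^sub>C x) = \<i> * L x" for x
  proof -
    have "\<i> *\<^sub>C \<i> *\<^sub>C x = (- 1) *\<^sub>R x"
      by (simp add: scaleC_scaleC flip: scaleC_of_real)
    then show ?thesis by (simp add: L_def lin complex_eq_iff linear_neg[OF l(1)])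
  qed
  have scale: "L (c *\<^sub>C x) = c * L x" for c x
  proof -
    have "c *\<^sub>C x = Re c *\<^sub>R x + Im c *\<^sub>R \<i> *\<^sub>C x"
      by (metis complex_eq scaleC_add_left scaleC_of_real scaleC_scaleC mult.commute)
    then have "L (c *\<^sub>C x) = (of_real (Re c) + \<i> * of_real (Im c)) * L x"
      by (simp only: add scaleR scale_i) (simp add: algebra_simps)
    then show ?thesis by (metis complex_eq)
  qed
  have bound: "cmod (L x) \<le> norm x" for x
  proof (cases "L x = 0")
    case False
    \<comment> \<open>A unimodular rotation makes the value of \<open>L\<close> real and
      nonnegative; it then coincides with \<open>l\<close>, which the norm dominates.\<close>
    define c where "c = cnj (L x) / of_real (cmod (L x))"
    have c: "cmod c = 1" using False by (simp add: c_def norm_divide)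
    have "c * L x = of_real (cmod (L x))"
      using False complex_norm_square[of "L x"] by (simp add: c_def power2_eq_square divide_eq_eq mult.commute)
    then have "L (c *\<^sub>C x) = of_real (cmod (L x))" by (simp add: scale)
    then have "cmod (L x) = l (c *\<^sub>C x)" by (simp add: L_def complex_eq_iff)
    also have "\<dots> \<le> norm (c *\<^sub>C x)" by (rule l)
    finally show ?thesis by (simp add: norm_scaleC c)
  qed simp
  have "bounded_linear L"
    by (rule bounded_linear_intro[of L 1]) (simp_all add: add scaleR bound scaleR_conv_of_real)
  then have "bounded_clinear L"
    by (simp add: bounded_clinear_def scale scaleC_complex_def)
  have "Re (L z) = norm z" by (simp add: L_def l)
  \<comment> \<open>The modulus of \<open>L z\<close> is at most \<open>norm z\<close>, which the
    real part already exhausts.\<close>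
  moreover have "Im (L z) = 0"
    using power_mono[OF bound norm_ge_zero, of z 2] \<open>Re (L z) = norm z\<close> by (simp add: cmod_power2)
  ultimately have "L z = of_real (norm z)" by (simp add: complex_eq_iff)
  have "onorm L \<le> 1"
    by (rule onorm_bound) (simp_all add: bound)
  moreover have "norm z \<le> onorm L * norm z"
    using onorm[OF \<open>bounded_linear L\<close>, of z] \<open>L z = of_real (norm z)\<close> by simp
  ultimately have "onorm L = 1" using assms by simp
  then show ?thesis
    using \<open>bounded_clinear L\<close> \<open>L z = of_real (norm z)\<close> unfolding support_functionals_def by blast
qed

lemma support_functionalsD:
  assumes "l \<in> support_functionals z"
  shows "bounded_clinear l" and "l z = complex_of_real (norm z)" and "cmod (l x) \<le> norm x"
  using assms onorm[of l x] bounded_clinear_imp_bounded_linear[of l]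
  by (auto simp: support_functionals_def)

section \<open>Starlike mappings of the form \<open>z f(z)\<close>\<close>

lemma Re_inverse_pos: "0 < Re x \<Longrightarrow> 0 < Re (inverse x)"
  by (auto intro!: divide_pos_pos add_pos_nonneg)

lemma has_derivative_scaleC_identity:
  fixes f :: "'a::complex_normed_vector \<Rightarrow> complex"
  assumes "frechet_holomorphic_on f U" and "open U"
    and "\<And>w. w \<in> U \<Longrightarrow> F w = f w *\<^sub>C w" and "w \<in> U"
  shows "(F has_derivative (\<lambda>h. f w *\<^sub>C h + frechet_derivative f (at w) h *\<^sub>C w)) (at w)"
  by (rule has_derivative_transform_within_open[OF _ \<open>open U\<close> \<open>w \<in> U\<close>])
    (use scaleC.FDERIV[OF frechet_holomorphic_onD(1)[OF assms(1,4)] has_derivative_ident] assms(3)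
      in auto)

lemma frechet_derivative_along_line:
  fixes f :: "'a::complex_normed_vector \<Rightarrow> complex"
  assumes "frechet_holomorphic_on f U" and "\<zeta> *\<^sub>C u \<in> U"
  shows "frechet_derivative f (at (\<zeta> *\<^sub>C u)) (\<zeta> *\<^sub>C u) = \<zeta> * deriv (\<lambda>\<zeta>. f (\<zeta> *\<^sub>C u)) \<zeta>"
proof -
  note D = frechet_holomorphic_onD[OF assms]
  have "((\<lambda>\<zeta>. f (\<zeta> *\<^sub>C u)) has_field_derivative frechet_derivative f (at (\<zeta> *\<^sub>C u)) u) (at \<zeta>)"
    using has_field_derivative_along_line[of f _ 0 \<zeta> u] D by simp
  then show ?thesis
    using bounded_clinear_scaleC_complex[OF D(2), of \<zeta> u] by (simp add: DERIV_imp_deriv)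
qed

lemma starlike_factor_at_zero:
  fixes f :: "'a::complex_normed_vector \<Rightarrow> complex"
  assumes "frechet_holomorphic_on f (ball 0 1)" and F: "\<And>w. w \<in> ball 0 1 \<Longrightarrow> F w = f w *\<^sub>C w"
    and star: "F \<in> starlike_mappings" and "(u :: 'a) \<noteq> 0"
  shows "f 0 = 1"
proof -
  have "(F has_derivative (\<lambda>h. f 0 *\<^sub>C h + frechet_derivative f (at 0) h *\<^sub>C 0)) (at 0)"
    using has_derivative_scaleC_identity[OF assms(1) open_ball F] by simp
  from frechet_derivative_at[OF this] have "f 0 *\<^sub>C u = u"
    using star unfolding starlike_mappings_def normalized_mapping_def
    by (auto simp: fun_eq_iff scaleC.zero_right)
  then have "(f 0 - 1) *\<^sub>C u = 0" by (simp add: scaleC.diff_left)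
  then have "cmod (f 0 - 1) * norm u = 0" by (metis norm_scaleC norm_zero)
  then show ?thesis using \<open>u \<noteq> 0\<close> by simp
qed

text \<open>\<open>w\<close> is an eigenvector of \<open>DF(w)\<close> with eigenvalue
  \<open>d\<close>, nonzero by injectivity. Hence \<open>DF(w)^(-1) F(w) = (f w / d) w\<close>, a
  support functional at \<open>w\<close> sends it to \<open>(f w / d) * norm w\<close>, and taking
  reciprocals preserves positivity of the real part.\<close>

lemma starlike_factor_Re_pos:
  fixes f :: "'a::complex_normed_vector \<Rightarrow> complex"
  assumes "frechet_holomorphic_on f (ball 0 1)" and F: "\<And>w. w \<in> ball 0 1 \<Longrightarrow> F w = f w *\<^sub>C w"
    and star: "F \<in> starlike_mappings" and w: "w \<in> ball 0 1" "w \<noteq> 0"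
  shows "f w \<noteq> 0" and "0 < Re (1 + frechet_derivative f (at w) w / f w)"
proof -
  let ?T = "frechet_derivative F (at w)"
  define d where "d = f w + frechet_derivative f (at w) w"
  have T: "?T = (\<lambda>h. f w *\<^sub>C h + frechet_derivative f (at w) h *\<^sub>C w)"
    using frechet_derivative_at[OF has_derivative_scaleC_identity[OF assms(1) open_ball F w(1)]] by simp
  have Tw: "?T w = d *\<^sub>C w" by (simp add: T d_def scaleC_add_left)
  have bij: "bij ?T"
    using star w unfolding starlike_mappings_def locally_biholomorphic_def by blast
  have lin: "bounded_clinear ?T"
    using frechet_holomorphic_onD(2) star w(1) unfolding starlike_mappings_def by blast
  then have T0: "?T 0 = 0"
    by (rule linear_0[OF bounded_linear.linear[OF bounded_clinear_imp_bounded_linear]])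
  have "d \<noteq> 0"
  proof
    assume "d = 0"
    then have "?T w = ?T 0" using Tw T0 by (simp add: scaleC.zero_left)
    then show False using bij w(2) by (simp add: bij_def inj_eq)
  qed
  then have "?T ((f w / d) *\<^sub>C w) = F w"
    by (simp add: bounded_clinear_scaleC[OF lin] Tw scaleC_scaleC F[OF w(1)])
  then have inv: "inv ?T (F w) = (f w / d) *\<^sub>C w"
    using bij by (metis bij_inv_eq_iff)
  obtain l where l: "l \<in> support_functionals w"
    using support_functionals_nonempty[OF w(2)] by blast
  then have "0 < Re (l (inv ?T (F w)))"
    using star w unfolding starlike_mappings_def by blast
  then have "0 < Re (f w / d * of_real (norm w))"
    by (simp add: inv bounded_clinear_scaleC_complex[OF support_functionalsD(1)[OF l]]
        support_functionalsD(2)[OF l])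
  then have "0 < Re (f w / d) * norm w"
    by (simp only: times_complex.sel Re_complex_of_real Im_complex_of_real mult_zero_right diff_zero)
  then have pos: "0 < Re (f w / d)"
    using w(2) by (simp only: zero_less_mult_iff) auto
  then show "f w \<noteq> 0" by auto
  have "0 < Re (inverse (f w / d))"
    by (rule Re_inverse_pos[OF pos])
  then show "0 < Re (1 + frechet_derivative f (at w) w / f w)"
    using \<open>f w \<noteq> 0\<close> by (simp add: d_def add_divide_distrib)
qed

section \<open>Normalized derivatives at 0 as Taylor coefficients along a ray\<close>

lemma frechet_D_replicate_scaleC_identity:
  fixes f :: "'a::complex_normed_vector \<Rightarrow> complex"
  assumes "frechet_holomorphic_on f (ball 0 1)" and "\<And>w. w \<in> ball 0 1 \<Longrightarrow> F w = f w *\<^sub>C w"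
  shows "frechet_D F (replicate (Suc m) (c *\<^sub>C u)) 0
    = (of_nat (Suc m) * (c ^ m * (deriv ^^ m) (\<lambda>\<zeta>. f (\<zeta> *\<^sub>C u)) 0)) *\<^sub>C c *\<^sub>C u"
proof -
  let ?z = "c *\<^sub>C u"
  have del: "take i (replicate (Suc m) ?z) @ drop (Suc i) (replicate (Suc m) ?z) = replicate m ?z"
    if "i < Suc m" for i
    using that by (simp add: take_replicate drop_replicate min_def replicate_add[symmetric] del: replicate_Suc)
  \<comment> \<open>All \<open>Suc m\<close> deletions leave the same list; their number is the
    factor that reduces \<open>fact (Suc m)\<close> to \<open>fact m\<close>.\<close>
  have "frechet_D F (replicate (Suc m) ?z) 0 = (\<Sum>i<Suc m. frechet_D f (replicate m ?z) 0 *\<^sub>C ?z)"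
    by (subst frechet_D_scaleC_identity[OF assms(1) open_ball assms(2)])
      (auto simp only: scaleC.zero_right del nth_replicate length_replicate lessThan_iff add_0_left
        norm_zero zero_less_one centre_in_ball intro!: sum.cong)
  also have "\<dots> = of_nat (Suc m) *\<^sub>C frechet_D f (replicate m ?z) 0 *\<^sub>C ?z"
    by (simp only: sum_constant_scaleR card_lessThan scaleC_of_real[symmetric] of_real_of_nat_eq)
  also have "frechet_D f (replicate m ?z) 0 = c ^ m * (deriv ^^ m) (\<lambda>\<zeta>. f (\<zeta> *\<^sub>C u)) 0"
    using frechet_D_along_line[OF assms(1) open_ball, of 0 u m c] by (simp add: scaleC.zero_left)
  finally show ?thesis by (simp only: scaleC_scaleC mult.assoc)
qed

text \<open>The derivative is a multiple of \<open>z\<close>, so \<open>l\<close> enters only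
  through \<open>l z = norm z\<close> and every support functional gives the same value. The factor
  \<open>w\<close> in \<open>F w\<close> shifts the index: order \<open>Suc m\<close> yields
  coefficient \<open>m\<close>.\<close>

lemma normalized_coefficient:
  fixes f :: "'a::complex_normed_vector \<Rightarrow> complex"
  assumes "frechet_holomorphic_on f (ball 0 1)" and "\<And>w. w \<in> ball 0 1 \<Longrightarrow> F w = f w *\<^sub>C w"
    and l: "l \<in> support_functionals z" and z: "z = of_real (norm z) *\<^sub>C u" "z \<noteq> 0"
  shows "l (frechet_D F (replicate (Suc m) z) 0)
      / (fact (Suc m) * complex_of_real (norm z ^ Suc m))
    = fps_nth (fps_expansion (\<lambda>\<zeta>. f (\<zeta> *\<^sub>C u)) 0) m"
proof -
  let ?a = "(deriv ^^ m) (\<lambda>\<zeta>. f (\<zeta> *\<^sub>C u)) 0" and ?r = "complex_of_real (norm z)"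
  have "frechet_D F (replicate (Suc m) z) 0 = (of_nat (Suc m) * (?r ^ m * ?a)) *\<^sub>C z"
    using frechet_D_replicate_scaleC_identity[OF assms(1,2), of m ?r u] by (simp only: z(1)[symmetric])
  then have "l (frechet_D F (replicate (Suc m) z) 0) = of_nat (Suc m) * (?r ^ m * ?a) * ?r"
    by (simp only: bounded_clinear_scaleC_complex[OF support_functionalsD(1)[OF l]]
        support_functionalsD(2)[OF l])
  then have "l (frechet_D F (replicate (Suc m) z) 0) / (fact (Suc m) * complex_of_real (norm z ^ Suc m))
      = (of_nat (Suc m) * ?r ^ Suc m * ?a) / (of_nat (Suc m) * ?r ^ Suc m * fact m)"
    by (simp only: fact_Suc of_real_power of_real_mult power_Suc mult_ac)
  also have "\<dots> = ?a / fact m" using z(2) by (simp del: of_nat_Suc)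
  finally show ?thesis by (simp add: fps_expansion_def)
qed

text \<open>\<open>F w - w\<close> is again a scalar multiple of \<open>w\<close>, with factor
  \<open>f w - 1\<close>; subtracting 1 leaves the coefficients of positive index unchanged.\<close>

lemma zero_of_order_imp_coeffs_vanish:
  fixes f :: "'a::complex_normed_vector \<Rightarrow> complex"
  assumes holf: "frechet_holomorphic_on f (ball 0 1)" and F: "\<And>w. w \<in> ball 0 1 \<Longrightarrow> F w = f w *\<^sub>C w"
    and zero: "zero_of_order (\<lambda>w. F w - w) (k + 1)" and "norm u = 1" and j: "0 < j" "j < k"
  shows "fps_nth (fps_expansion (\<lambda>\<zeta>. f (\<zeta> *\<^sub>C u)) 0) j = 0"
proof -
  let ?g = "\<lambda>w. f w - 1" and ?\<phi> = "\<lambda>\<zeta>. f (\<zeta> *\<^sub>C u)"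
  have holg: "frechet_holomorphic_on ?g (ball 0 1)"
  proof (rule frechet_holomorphic_onI)
    fix w :: 'a assume w: "w \<in> ball 0 1"
    show "(?g has_derivative frechet_derivative f (at w)) (at w)"
      using has_derivative_diff[OF frechet_holomorphic_onD(1)[OF holf w] has_derivative_const] by simp
  qed (rule frechet_holomorphic_onD[OF holf])
  have "u \<noteq> 0" using \<open>norm u = 1\<close> by auto
  then obtain l where l: "l \<in> support_functionals u"
    using support_functionals_nonempty by blast
  \<comment> \<open>Coefficient \<open>j\<close> sits in the derivative of order
    \<open>j + 1\<close>, so \<open>j < k\<close> matches a zero of order
    \<open>k + 1\<close>.\<close>
  have "length (replicate (Suc j) u) < k + 1" using j by simp
  then have "frechet_D (\<lambda>w. F w - w) (replicate (Suc j) u) 0 = 0"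
    using zero unfolding zero_of_order_def by blast
  then have "fps_nth (fps_expansion (\<lambda>\<zeta>. ?\<phi> \<zeta> - 1) 0) j = 0"
    using normalized_coefficient[OF holg _ l, of "\<lambda>w. F w - w" u j] \<open>norm u = 1\<close> \<open>u \<noteq> 0\<close>
      linear_0[OF bounded_linear.linear[OF bounded_clinear_imp_bounded_linear[OF support_functionalsD(1)[OF l]]]]
    by (auto simp: F scaleC.diff_left simp del: replicate_Suc)
  moreover have "?\<phi> holomorphic_on ball 0 1"
    using holomorphic_on_along_line[OF holf, of "ball 0 1" 0 u] \<open>norm u = 1\<close> by (simp add: norm_scaleC)
  then have "fps_expansion (\<lambda>\<zeta>. ?\<phi> \<zeta> - 1) 0 = fps_expansion ?\<phi> 0 - 1"
    by (intro fps_expansion_unique_complex[OF holomorphic_has_fps_expansion] fps_expansion_intros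
        holomorphic_has_fps_expansion holomorphic_intros)
  ultimately show ?thesis using j by simp
qed

lemma starlike_one_dimensional_type_bound:
  fixes f :: "'a::complex_normed_vector \<Rightarrow> complex"
  assumes holf: "frechet_holomorphic_on f (ball 0 1)" and F: "\<And>w. w \<in> ball 0 1 \<Longrightarrow> F w = f w *\<^sub>C w"
    and star: "F \<in> starlike_mappings" and zero: "zero_of_order (\<lambda>w. F w - w) (k + 1)"
    and "k \<ge> 1" and "z \<noteq> 0" and l: "l \<in> support_functionals z"
  shows "cmod ((l (frechet_D F (replicate (2 * k + 1) z) 0)
              / (fact (2 * k + 1) * complex_of_real (norm z ^ (2 * k + 1))))\<^sup>2
           - (l (frechet_D F (replicate (k + 1) z) 0)
              / (fact (k + 1) * complex_of_real (norm z ^ (k + 1))))\<^sup>2)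
         \<le> (real k + 2)\<^sup>2 / real k ^ 4 + 4 / (real k)\<^sup>2"
proof -
  define u where "u = complex_of_real (1 / norm z) *\<^sub>C z"
  have u: "norm u = 1" using \<open>z \<noteq> 0\<close> by (simp add: u_def norm_scaleC norm_divide)
  then have "u \<noteq> 0" by auto
  have zu: "z = of_real (norm z) *\<^sub>C u"
    using \<open>z \<noteq> 0\<close> by (simp add: u_def scaleC_scaleC flip: of_real_mult)
  define \<phi> where "\<phi> \<zeta> = f (\<zeta> *\<^sub>C u)" for \<zeta>
  define p where "p \<zeta> = 1 + \<zeta> * deriv \<phi> \<zeta> / \<phi> \<zeta>" for \<zeta>
  have in_ball: "\<zeta> *\<^sub>C u \<in> ball 0 1" if "\<zeta> \<in> ball 0 1" for \<zeta>
    using that u by (simp add: norm_scaleC)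
  have hol\<phi>: "\<phi> holomorphic_on ball 0 1"
    unfolding \<phi>_def using holomorphic_on_along_line[OF holf, of "ball 0 1" 0 u] in_ball by simp
  have \<phi>0: "\<phi> 0 = 1"
    using starlike_factor_at_zero[OF holf F star \<open>u \<noteq> 0\<close>] by (simp add: \<phi>_def scaleC.zero_left)
  \<comment> \<open>Starlikeness speaks of nonzero points only; at 0 the formula for
    \<open>p\<close> gives the value 1.\<close>
  have main: "\<phi> \<zeta> \<noteq> 0 \<and> 0 < Re (p \<zeta>)" if "\<zeta> \<in> ball 0 1" for \<zeta>
  proof (cases "\<zeta> = 0")
    case True
    then show ?thesis using \<phi>0 by (simp add: p_def)
  next
    case False
    then have "\<zeta> *\<^sub>C u \<noteq> 0" using u norm_scaleC[of \<zeta> u] by auto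
    from starlike_factor_Re_pos[OF holf F star in_ball[OF that] this]
    show ?thesis
      unfolding p_def \<phi>_def using frechet_derivative_along_line[OF holf in_ball[OF that]] by simp
  qed
  have holp: "p holomorphic_on ball 0 1"
    unfolding p_def using main by (intro holomorphic_intros hol\<phi>) auto
  have "\<zeta> * deriv \<phi> \<zeta> = \<phi> \<zeta> * (p \<zeta> - 1)" if "\<zeta> \<in> ball 0 1" for \<zeta>
    using main[OF that] by (simp add: p_def)
  then have "cmod ((fps_nth (fps_expansion \<phi> 0) (2 * k))\<^sup>2 - (fps_nth (fps_expansion \<phi> 0) k)\<^sup>2)
      \<le> (real k + 2)\<^sup>2 / real k ^ 4 + 4 / (real k)\<^sup>2"
    using main zero_of_order_imp_coeffs_vanish[OF holf F zero u]
    by (intro starlike_coefficient_bound[OF hol\<phi> holp _ _ \<phi>0 \<open>k \<ge> 1\<close>]) (auto simp: \<phi>_def[abs_def])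
  then show ?thesis
    using normalized_coefficient[OF holf F l zu \<open>z \<noteq> 0\<close>, of k]
      normalized_coefficient[OF holf F l zu \<open>z \<noteq> 0\<close>, of "2 * k"]
    by (simp only: Suc_eq_plus1 \<phi>_def[abs_def])
qed

section \<open>The extremal mapping\<close>

text \<open>The principal branch of \<open>(1 - \<i> \<zeta>^k)^(-2/k)\<close>, which solves
  \<open>\<zeta> \<phi>' / \<phi> = 2 \<i> \<zeta>^k / (1 - \<i> \<zeta>^k)\<close>. For
  \<open>k = 1\<close>, \<open>\<zeta> \<phi>(\<zeta>)\<close> is a rotation of the Koebe
  function.\<close>

definition koebe_factor :: "nat \<Rightarrow> complex \<Rightarrow> complex" where
  "koebe_factor k \<zeta> = exp (- (2 / of_nat k) * Ln (1 - \<i> * \<zeta> ^ k))"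

lemma koebe_factor_nonzero: "koebe_factor k \<zeta> \<noteq> 0"
  by (simp add: koebe_factor_def)

lemma norm_power_lt_one:
  fixes \<zeta> :: complex
  assumes "k \<ge> 1" and "\<zeta> \<in> ball 0 1"
  shows "cmod (\<i> * \<zeta> ^ k) < 1"
  using assms by (simp add: norm_mult norm_power power_less_one_iff)

lemma one_minus_nonzero:
  fixes s :: complex
  assumes "cmod s < 1"
  shows "1 - s \<noteq> 0"
  using assms by auto

lemma koebe_factor_DERIV:
  assumes "k \<ge> 1" and \<zeta>: "\<zeta> \<in> ball 0 1"
  shows "(koebe_factor k has_field_derivative
      koebe_factor k \<zeta> * (2 * \<i> * \<zeta> ^ (k - 1) / (1 - \<i> * \<zeta> ^ k))) (at \<zeta>)"
proof -
  \<comment> \<open>The argument of the logarithm stays in the right half-plane, away from the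
    cut.\<close>
  have "Re (\<i> * \<zeta> ^ k) < 1"
    using norm_power_lt_one[OF assms] abs_Re_le_cmod[of "\<i> * \<zeta> ^ k"] by linarith
  then have "0 < Re (1 - \<i> * \<zeta> ^ k)" by simp
  then have nonpos: "1 - \<i> * \<zeta> ^ k \<notin> \<real>\<^sub>\<le>\<^sub>0" by (auto simp: complex_nonpos_Reals_iff)
  have k: "of_nat k \<noteq> (0::complex)" using \<open>k \<ge> 1\<close> by simp
  show ?thesis
    unfolding koebe_factor_def[abs_def]
    by (rule derivative_eq_intros refl nonpos)+ (use k in \<open>simp add: field_simps\<close>)
qed

lemma koebe_factor_zero: "k \<ge> 1 \<Longrightarrow> koebe_factor k 0 = 1"
  by (simp add: koebe_factor_def power_0_left)

lemma koebe_factor_holomorphic: "k \<ge> 1 \<Longrightarrow> koebe_factor k holomorphic_on ball 0 1"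
  using koebe_factor_DERIV by (meson holomorphic_on_open open_ball)

lemma koebe_factor_log_derivative:
  assumes "k \<ge> 1" and "\<zeta> \<in> ball 0 1"
  shows "\<zeta> * deriv (koebe_factor k) \<zeta> = koebe_factor k \<zeta> * (2 * \<i> * \<zeta> ^ k / (1 - \<i> * \<zeta> ^ k))"
proof -
  have "\<zeta> * \<zeta> ^ (k - 1) = \<zeta> ^ k" using \<open>k \<ge> 1\<close> by (cases k) simp_all
  then show ?thesis
    by (simp add: DERIV_imp_deriv[OF koebe_factor_DERIV[OF assms]] algebra_simps)
qed

lemma koebe_factor_coeffs:
  fixes k :: nat
  assumes "k \<ge> 1"
  defines "a \<equiv> fps_nth (fps_expansion (koebe_factor k) 0)"
  shows "\<And>j. 0 < j \<Longrightarrow> j < k \<Longrightarrow> a j = 0"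
    and "a k = 2 * \<i> / of_nat k"
    and "a (2 * k) = - ((of_nat k + 2) / (of_nat k)\<^sup>2)"
proof -
  define q where "q \<zeta> = 2 * \<i> * \<zeta> ^ k / (1 - \<i> * \<zeta> ^ k)" for \<zeta> :: complex
  let ?F = "fps_expansion (koebe_factor k) 0" and ?Q = "fps_expansion q 0"
  have nz: "1 - \<i> * \<zeta> ^ k \<noteq> 0" if "\<zeta> \<in> ball 0 1" for \<zeta> :: complex
    by (rule one_minus_nonzero[OF norm_power_lt_one[OF assms(1) that]])
  have holq: "q holomorphic_on ball 0 1"
    unfolding q_def using nz by (intro holomorphic_intros) auto
  have FQ: "fps_X * fps_deriv ?F = ?F * ?Q"
    by (rule log_derivative_fps_expansion[OF koebe_factor_holomorphic[OF assms(1)] holq])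
      (simp add: koebe_factor_log_derivative[OF assms(1)] q_def)
  have F0: "fps_nth ?F 0 = 1"
    by (simp add: fps_expansion_def koebe_factor_zero[OF \<open>k \<ge> 1\<close>])
  \<comment> \<open>With the denominator cleared, the geometric series is read off as a recursion of
    step \<open>k\<close>.\<close>
  have Q: "?Q * (1 - fps_const \<i> * fps_X ^ k) = fps_const (2 * \<i>) * fps_X ^ k"
  proof (rule fps_expansion_unique_complex)
    have "(\<lambda>\<zeta>. q \<zeta> * (1 - \<i> * \<zeta> ^ k)) has_fps_expansion ?Q * (1 - fps_const \<i> * fps_X ^ k)"
      by (intro fps_expansion_intros holomorphic_has_fps_expansion holq)
    moreover have "eventually (\<lambda>\<zeta>. q \<zeta> * (1 - \<i> * \<zeta> ^ k) = 2 * \<i> * \<zeta> ^ k) (nhds 0)"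
      unfolding eventually_nhds using nz by (intro exI[of _ "ball 0 1"]) (auto simp: q_def)
    ultimately show "(\<lambda>\<zeta>. 2 * \<i> * \<zeta> ^ k) has_fps_expansion ?Q * (1 - fps_const \<i> * fps_X ^ k)"
      using has_fps_expansion_cong by metis
    show "(\<lambda>\<zeta>. 2 * \<i> * \<zeta> ^ k) has_fps_expansion fps_const (2 * \<i>) * fps_X ^ k"
      by (intro fps_expansion_intros)
  qed
  have Qeq: "?Q = fps_const (2 * \<i>) * fps_X ^ k + fps_const \<i> * (fps_X ^ k * ?Q)"
    using Q by (simp add: algebra_simps)
  have Qn: "fps_nth ?Q n = (if n = k then 2 * \<i> else 0) + \<i> * (if n < k then 0 else fps_nth ?Q (n - k))" for n
    by (subst Qeq) (simp add: fps_X_power_mult_nth fps_X_power_nth)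
  have Q0: "fps_nth ?Q j = 0" if "j < k" for j
    using Qn[of j] that by simp
  have Qk: "fps_nth ?Q k = 2 * \<i>"
    using Qn[of k] Q0[of 0] \<open>k \<ge> 1\<close> by simp
  have Q2k: "fps_nth ?Q (2 * k) = - 2"
    using Qn[of "2 * k"] Qk \<open>k \<ge> 1\<close> by simp
  show van: "a j = 0" if "0 < j" "j < k" for j
    unfolding a_def by (rule coeffs_vanish_of_log_derivative[OF FQ Q0 that])
  note rel = log_derivative_coeffs[OF FQ F0 \<open>k \<ge> 1\<close> van[unfolded a_def] Q0, folded a_def]
  have k: "of_nat k \<noteq> (0::complex)" using \<open>k \<ge> 1\<close> by simp
  show ak: "a k = 2 * \<i> / of_nat k"
    using rel(1) k by (simp add: Qk field_simps)
  define c where "c = a (2 * k)"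
  \<comment> \<open>Both contributions are negative, \<open>- 2\<close> and \<open>- 4 / k\<close>,
    so their moduli add and the bound for this coefficient is attained too.\<close>
  have "2 * of_nat k * c = - 2 + 2 * \<i> / of_nat k * (2 * \<i>)"
    using rel(2) by (simp only: Qk Q2k ak c_def)
  then have "2 * (of_nat k * c) = 2 * (- 1 - 2 / of_nat k)"
    by (simp add: algebra_simps)
  then have "of_nat k * c = - 1 - 2 / of_nat k"
    by (simp only: mult_cancel_left) simp
  then have "c = - ((of_nat k + 2) / (of_nat k)\<^sup>2)"
    using k by (simp add: field_simps power2_eq_square)
  then show "a (2 * k) = - ((of_nat k + 2) / (of_nat k)\<^sup>2)" by (simp only: c_def)
qed

text \<open>The Sherman-Morrison formula: applying \<open>l\<close> to \<open>T h = y\<close> gives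
  \<open>l h = l y / (a + b * l w)\<close>, after which \<open>h\<close> can be solved for; this is
  \<open>S\<close>.\<close>

lemma rank_one_perturbation_inverse:
  fixes l :: "'a::complex_normed_vector \<Rightarrow> complex" and w :: 'a
  assumes l: "bounded_clinear l" and "a \<noteq> 0" and "a + b * l w \<noteq> 0"
  defines "T \<equiv> \<lambda>h. a *\<^sub>C h + (b * l h) *\<^sub>C w"
  shows "bij T" and "bounded_clinear (inv T)" and "inv T (c *\<^sub>C w) = (c / (a + b * l w)) *\<^sub>C w"
proof -
  let ?d = "a + b * l w"
  define S where "S y = inverse a *\<^sub>C (y - (b * l y / ?d) *\<^sub>C w)" for y
  have bl: "bounded_linear l" by (rule bounded_clinear_imp_bounded_linear[OF l])
  note lin = bounded_clinear_scaleC_complex[OF l] linear_diff[OF bounded_linear.linear[OF bl]]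
    linear_add[OF bounded_linear.linear[OF bl]]
  have lS: "l (S y) = l y / ?d" for y
  proof -
    have "l (S y) = inverse a * (l y * (1 - b * l w / ?d))"
      by (simp add: S_def lin algebra_simps)
    also have "1 - b * l w / ?d = a / ?d" using assms(3) by (simp add: field_simps)
    finally show ?thesis using \<open>a \<noteq> 0\<close> by simp
  qed
  have TS: "T (S y) = y" for y
    using \<open>a \<noteq> 0\<close> by (simp add: T_def lS) (simp add: S_def scaleC_scaleC)
  have ST: "S (T h) = h" for h
  proof -
    have "l (T h) = l h * ?d" by (simp add: T_def lin algebra_simps)
    then show ?thesis
      using \<open>a \<noteq> 0\<close> assms(3) by (simp add: S_def) (simp add: T_def scaleC_scaleC)
  qed
  show "bij T" by (rule o_bij[of S]) (auto simp: fun_eq_iff TS ST)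
  have inv: "inv T = S" by (rule inv_equality) (simp_all add: TS ST)
  have "bounded_linear S"
    unfolding S_def
    by (intro bounded_linear_compose[OF scaleC.bounded_linear_right] bounded_linear_sub
        bounded_linear_ident bounded_linear_compose[OF scaleC.bounded_linear_left]
        bounded_linear_compose[OF bounded_linear_divide] bounded_linear_compose[OF bounded_linear_mult_right] bl)
  moreover have "S (c *\<^sub>C y) = c *\<^sub>C S y" for c y
    by (simp add: S_def lin scaleC.diff_right scaleC_scaleC mult_ac)
  ultimately show "bounded_clinear (inv T)" by (simp add: inv bounded_clinear_def)
  have "T ((c / ?d) *\<^sub>C w) = (c / ?d * ?d) *\<^sub>C w"
    by (simp only: T_def lin scaleC_scaleC scaleC_add_left[symmetric])
      (simp add: algebra_simps add_divide_distrib)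
  then have "T ((c / ?d) *\<^sub>C w) = c *\<^sub>C w" using assms(3) by simp
  then show "inv T (c *\<^sub>C w) = (c / ?d) *\<^sub>C w" by (metis inv ST)
qed

lemma frechet_holomorphic_on_compose_functional:
  fixes l :: "'a::complex_normed_vector \<Rightarrow> complex"
  assumes l: "bounded_clinear l" and \<psi>: "\<psi> holomorphic_on S" "open S" and sub: "l ` U \<subseteq> S"
  shows "frechet_holomorphic_on (\<lambda>w. \<psi> (l w)) U"
    and "w \<in> U \<Longrightarrow> frechet_derivative (\<lambda>w. \<psi> (l w)) (at w) = (\<lambda>h. deriv \<psi> (l w) * l h)"
proof -
  have bl: "bounded_linear l" by (rule bounded_clinear_imp_bounded_linear[OF l])
  have D: "((\<lambda>w. \<psi> (l w)) has_derivative (\<lambda>h. deriv \<psi> (l w) * l h)) (at w)" if "w \<in> U" for w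
  proof -
    have "(\<psi> has_derivative (*) (deriv \<psi> (l w))) (at (l w))"
      using holomorphic_derivI[OF \<psi>, of "l w"] that sub by (auto simp: has_field_derivative_def)
    from has_derivative_compose[OF bounded_linear.has_derivative[OF bl has_derivative_ident] this]
    show ?thesis .
  qed
  show "frechet_holomorphic_on (\<lambda>w. \<psi> (l w)) U"
  proof (rule frechet_holomorphic_onI[OF D])
    fix w assume "w \<in> U"
    show "bounded_clinear (\<lambda>h. deriv \<psi> (l w) * l h)"
      using has_derivative_bounded_linear[OF D[OF \<open>w \<in> U\<close>]]
      by (simp add: bounded_clinear_def bounded_clinear_scaleC_complex[OF l] scaleC_complex_def)
  qed
  show "w \<in> U \<Longrightarrow> frechet_derivative (\<lambda>w. \<psi> (l w)) (at w) = (\<lambda>h. deriv \<psi> (l w) * l h)"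
    using frechet_derivative_at[OF D] by simp
qed

text \<open>At most \<open>k\<close> directions become fewer than \<open>k\<close> after a deletion,
  where the derivatives of \<open>\<psi>\<close> vanish; \<open>k + 1\<close> copies of
  \<open>u\<close> give \<open>(k + 1) * (deriv ^^ k) \<psi> 0\<close> times
  \<open>u\<close>.\<close>

lemma zero_of_order_scaleC_identity:
  fixes l :: "'a::complex_normed_vector \<Rightarrow> complex"
  assumes hol: "\<psi> holomorphic_on ball 0 1" and l: "l \<in> support_functionals u" and "norm u = 1"
    and vanish: "\<And>j. j < k \<Longrightarrow> (deriv ^^ j) \<psi> 0 = 0" and "(deriv ^^ k) \<psi> 0 \<noteq> 0"
    and G: "\<And>w. w \<in> ball 0 1 \<Longrightarrow> G w = \<psi> (l w) *\<^sub>C w"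
  shows "zero_of_order G (k + 1)"
proof -
  note bl = support_functionalsD(1)[OF l]
  have l0: "l 0 = 0"
    by (rule linear_0[OF bounded_linear.linear[OF bounded_clinear_imp_bounded_linear[OF bl]]])
  have "l ` ball 0 1 \<subseteq> ball 0 1"
    using le_less_trans[OF support_functionalsD(3)[OF l]] by auto
  note holf = frechet_holomorphic_on_compose_functional(1)[OF bl hol open_ball this]
  have D: "frechet_D (\<lambda>w. \<psi> (l w)) hs 0 = 0" if "length hs < k" for hs
    using frechet_D_compose_functional[OF bl hol open_ball, of 0 hs] vanish[OF that] by (simp add: l0)
  have "frechet_D G hs 0 = 0" if "length hs < k + 1" for hs
  proof -
    have "frechet_D (\<lambda>w. \<psi> (l w)) (take i hs @ drop (Suc i) hs) 0 = 0" if "i < length hs" for i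
      using that \<open>length hs < k + 1\<close> by (intro D) auto
    then show ?thesis
      by (subst frechet_D_scaleC_identity[OF holf open_ball G])
        (auto simp: scaleC.zero_right scaleC.zero_left)
  qed
  moreover have "(\<lambda>\<zeta>. \<psi> (l (\<zeta> *\<^sub>C u))) = \<psi>"
    by (simp add: bounded_clinear_scaleC_complex[OF bl] support_functionalsD(2)[OF l] \<open>norm u = 1\<close>)
  then have "frechet_D G (replicate (Suc k) u) 0 = (of_nat (Suc k) * (deriv ^^ k) \<psi> 0) *\<^sub>C u"
    using frechet_D_replicate_scaleC_identity[OF holf G, of k 1 u] by (simp del: replicate_Suc of_nat_Suc)
  then have "norm (frechet_D G (replicate (Suc k) u) 0) \<noteq> 0"
    using assms(5) \<open>norm u = 1\<close> by (simp add: norm_scaleC norm_mult del: replicate_Suc of_nat_Suc)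
  then have "\<exists>hs. length hs = k + 1 \<and> frechet_D G hs 0 \<noteq> 0"
    by (intro exI[of _ "replicate (Suc k) u"]) (auto simp del: replicate_Suc)
  ultimately show ?thesis unfolding zero_of_order_def by auto
qed

text \<open>\<open>DF(w)\<close> is a multiple of the identity plus a rank-one operator, with
  \<open>DF(w)^(-1) F(w) = w / P (l w)\<close>. Any functional supporting \<open>w\<close> sends
  this to \<open>norm w / P (l w)\<close>, so positivity of \<open>Re P\<close> on the disc
  suffices.\<close>

lemma starlike_extremal_exists:
  fixes u :: "'a::complex_normed_vector"
  assumes l: "l \<in> support_functionals u" and u: "norm u = 1" and k: "k \<ge> 1"
  defines "f \<equiv> \<lambda>w. koebe_factor k (l w)" and "F \<equiv> \<lambda>w. koebe_factor k (l w) *\<^sub>C w"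
  shows "frechet_holomorphic_on f (ball 0 1)" and "F \<in> starlike_mappings"
    and "zero_of_order (\<lambda>w. F w - w) (k + 1)"
proof -
  let ?\<psi> = "koebe_factor k"
  note bl = support_functionalsD(1)[OF l]
  note hol\<psi> = koebe_factor_holomorphic[OF k]
  have l0: "l 0 = 0"
    by (rule linear_0[OF bounded_linear.linear[OF bounded_clinear_imp_bounded_linear[OF bl]]])
  have lw: "l w \<in> ball 0 1" if "w \<in> ball 0 1" for w
    using that support_functionalsD(3)[OF l, of w] by simp
  then have "l ` ball 0 1 \<subseteq> ball 0 1" by blast
  note comp = frechet_holomorphic_on_compose_functional[OF bl hol\<psi> open_ball this, folded f_def]
  show holf: "frechet_holomorphic_on f (ball 0 1)" by (rule comp)
  note \<psi>0 = koebe_factor_zero[OF k]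
  define T where "T w = (\<lambda>h. ?\<psi> (l w) *\<^sub>C h + (deriv ?\<psi> (l w) * l h) *\<^sub>C w)" for w
  have D: "(F has_derivative T w) (at w)" if "w \<in> ball 0 1" for w
    using has_derivative_scaleC_identity[OF holf open_ball _ that, of F] comp(2)[OF that]
    by (simp add: F_def f_def T_def)
  have TD: "frechet_derivative F (at w) = T w" if "w \<in> ball 0 1" for w
    using frechet_derivative_at[OF D[OF that]] by simp
  have holF: "frechet_holomorphic_on F (ball 0 1)"
  proof (rule frechet_holomorphic_onI[OF D])
    fix w :: 'a assume "w \<in> ball 0 1"
    then show "bounded_clinear (T w)"
      using has_derivative_bounded_linear[OF D]
      by (simp add: bounded_clinear_def T_def bounded_clinear_scaleC_complex[OF bl] scaleC_add_right
          scaleC_scaleC mult_ac)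
  qed
  define P where "P \<zeta> = 1 + 2 * \<i> * \<zeta> ^ k / (1 - \<i> * \<zeta> ^ k)" for \<zeta>
  have P: "0 < Re (P \<zeta>)" if "\<zeta> \<in> ball 0 1" for \<zeta>
  proof -
    define s where "s = \<i> * \<zeta> ^ k"
    have s: "cmod s < 1" unfolding s_def by (rule norm_power_lt_one[OF k that])
    then have "1 - s \<noteq> 0" by (rule one_minus_nonzero)
    \<comment> \<open>Positivity of \<open>Re P\<close> thus says that \<open>1 / (1 - s)\<close>
      has real part above 1/2 on the unit disc.\<close>
    then have *: "P \<zeta> = 2 * inverse (1 - s) - 1"
      by (simp add: P_def s_def divide_simps)
    have "(Re s)\<^sup>2 + (Im s)\<^sup>2 < 1"
      using s by (metis cmod_power2 norm_ge_zero power_less_one_iff pos2 abs_norm_cancel power2_abs abs_square_less_1)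
    moreover have "0 < (1 - Re s)\<^sup>2 + (Im s)\<^sup>2"
      using \<open>1 - s \<noteq> 0\<close> by (auto simp: sum_power2_gt_zero_iff complex_eq_iff)
    ultimately have "1 < 2 * Re (inverse (1 - s))"
      by (simp add: less_divide_eq power2_eq_square algebra_simps)
    moreover have "Re (P \<zeta>) = 2 * Re (inverse (1 - s)) - 1"
      by (simp only: * minus_complex.sel times_complex.sel complex_Re_numeral complex_Im_numeral
          one_complex.sel mult_zero_left diff_zero)
    ultimately show ?thesis by simp
  qed
  have d: "?\<psi> (l w) + deriv ?\<psi> (l w) * l w = ?\<psi> (l w) * P (l w)" if "w \<in> ball 0 1" for w
    using koebe_factor_log_derivative[OF k lw[OF that]] by (simp add: P_def algebra_simps)
  have d_nz: "?\<psi> (l w) + deriv ?\<psi> (l w) * l w \<noteq> 0" if "w \<in> ball 0 1" for w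
    using P[OF lw[OF that]] koebe_factor_nonzero[of k "l w"] by (auto simp: d[OF that])
  note T_inv = rank_one_perturbation_inverse[OF bl koebe_factor_nonzero d_nz, folded T_def]
  have "0 < Re (l' (inv (T w) (F w)))" if w: "w \<in> ball 0 1" "w \<noteq> 0" and l': "l' \<in> support_functionals w" for w l'
  proof -
    have "inv (T w) (F w) = inverse (P (l w)) *\<^sub>C w"
      unfolding F_def T_inv(3)[OF w(1)] d[OF w(1)] using koebe_factor_nonzero[of k "l w"]
      by (simp add: divide_inverse flip: mult.assoc)
    then have "l' (inv (T w) (F w)) = inverse (P (l w)) * of_real (norm w)"
      by (simp only: bounded_clinear_scaleC_complex[OF support_functionalsD(1)[OF l']]
          support_functionalsD(2)[OF l'])
    then have "Re (l' (inv (T w) (F w))) = Re (inverse (P (l w))) * norm w"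
      by (simp only: times_complex.sel Re_complex_of_real Im_complex_of_real mult_zero_right diff_zero)
    then show ?thesis
      using Re_inverse_pos[OF P[OF lw[OF w(1)]]] w(2) by (simp only: zero_less_mult_iff) auto
  qed
  moreover have "locally_biholomorphic F"
    unfolding locally_biholomorphic_def using TD T_inv(1,2) by simp
  moreover have "normalized_mapping F"
    unfolding normalized_mapping_def using TD[of 0]
    by (auto simp: F_def T_def l0 \<psi>0 scaleC.zero_right)
  ultimately show "F \<in> starlike_mappings"
    unfolding starlike_mappings_def using holF TD by auto
  show "zero_of_order (\<lambda>w. F w - w) (k + 1)"
  proof (rule zero_of_order_scaleC_identity[OF _ l u])
    let ?\<chi> = "\<lambda>\<zeta>. ?\<psi> \<zeta> - 1"
    show hol\<chi>: "?\<chi> holomorphic_on ball 0 1" by (intro holomorphic_intros hol\<psi>)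
    have "fps_expansion ?\<chi> 0 = fps_expansion ?\<psi> 0 - 1"
      by (intro fps_expansion_unique_complex[OF holomorphic_has_fps_expansion] fps_expansion_intros
          holomorphic_has_fps_expansion hol\<chi> hol\<psi>)
    then have deriv_eq: "(deriv ^^ j) ?\<chi> 0 = fact j * fps_nth (fps_expansion ?\<psi> 0) j" if "0 < j" for j
      using that fps_nth_fps_expansion[OF holomorphic_has_fps_expansion[OF hol\<chi>], of j] by simp
    show "(deriv ^^ j) ?\<chi> 0 = 0" if "j < k" for j
      using that deriv_eq[of j] koebe_factor_coeffs(1)[OF k, of j] \<psi>0 by (cases "j = 0") auto
    show "(deriv ^^ k) ?\<chi> 0 \<noteq> 0"
      using k deriv_eq[of k] koebe_factor_coeffs(2)[OF k] by simp
  qed (simp add: F_def scaleC.diff_left)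
qed

theorem theorem6:
  fixes k :: nat
  assumes "(UNIV :: 'a::complex_banach set) \<noteq> {0}"
    and "k \<ge> 1"
  shows
    "(\<forall>(f :: 'a \<Rightarrow> complex) (F :: 'a \<Rightarrow> 'a).
        frechet_holomorphic_on f (ball 0 1) \<and>
        (\<forall>z\<in>ball 0 1. F z = f z *\<^sub>C z) \<and>
        F \<in> starlike_mappings \<and>
        zero_of_order (\<lambda>z. F z - z) (k + 1) \<longrightarrow>
        (\<forall>z\<in>ball 0 1 - {0}. \<forall>l\<in>support_functionals z.
           cmod ((l (frechet_D F (replicate (2 * k + 1) z) 0)
                    / (fact (2 * k + 1) * complex_of_real (norm z ^ (2 * k + 1))))\<^sup>2
               - (l (frechet_D F (replicate (k + 1) z) 0)
                    / (fact (k + 1) * complex_of_real (norm z ^ (k + 1))))\<^sup>2)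
           \<le> (real k + 2)\<^sup>2 / real k ^ 4 + 4 / (real k)\<^sup>2)) \<and>
     (\<exists>(f :: 'a \<Rightarrow> complex) (F :: 'a \<Rightarrow> 'a).
        frechet_holomorphic_on f (ball 0 1) \<and>
        (\<forall>z\<in>ball 0 1. F z = f z *\<^sub>C z) \<and>
        F \<in> starlike_mappings \<and>
        zero_of_order (\<lambda>z. F z - z) (k + 1) \<and>
        (\<exists>z\<in>ball 0 1 - {0}. \<exists>l\<in>support_functionals z.
           cmod ((l (frechet_D F (replicate (2 * k + 1) z) 0)
                    / (fact (2 * k + 1) * complex_of_real (norm z ^ (2 * k + 1))))\<^sup>2
               - (l (frechet_D F (replicate (k + 1) z) 0)
                    / (fact (k + 1) * complex_of_real (norm z ^ (k + 1))))\<^sup>2)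
           = (real k + 2)\<^sup>2 / real k ^ 4 + 4 / (real k)\<^sup>2))"
  (is "?bound \<and> ?sharp")
proof
  show ?bound
    using starlike_one_dimensional_type_bound[OF _ _ _ _ \<open>k \<ge> 1\<close>] by blast
  obtain x :: 'a where "x \<noteq> 0" using assms(1) by blast
  define u where "u = (1 / norm x) *\<^sub>R x"
  have u: "norm u = 1" using \<open>x \<noteq> 0\<close> by (simp add: u_def)
  then have "u \<noteq> 0" by auto
  then obtain l where l: "l \<in> support_functionals u"
    using support_functionals_nonempty by blast
  let ?f = "\<lambda>w. koebe_factor k (l w)" and ?F = "\<lambda>w. koebe_factor k (l w) *\<^sub>C w"
  note ex = starlike_extremal_exists[OF l u \<open>k \<ge> 1\<close>]
  \<comment> \<open>A point of the open ball on the ray of \<open>u\<close>, which itself has norm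
    1; the normalized coefficients do not depend on the radius.\<close>
  define z where "z = complex_of_real (1 / 2) *\<^sub>C u"
  have nz: "norm z = 1 / 2" using u by (simp add: z_def norm_scaleC)
  then have z: "z \<in> ball 0 1 - {0}" by auto
  have lz: "l \<in> support_functionals z"
  proof -
    have "l z = complex_of_real (norm z)"
      unfolding nz using support_functionalsD(1,2)[OF l] u
      by (simp add: z_def bounded_clinear_scaleC_complex del: of_real_divide)
    then show ?thesis using l by (simp add: support_functionals_def)
  qed
  have zu: "z = complex_of_real (norm z) *\<^sub>C u" unfolding nz by (rule z_def)
  have "z \<noteq> 0" using z by simp
  have "(\<lambda>\<zeta>. koebe_factor k (l (\<zeta> *\<^sub>C u))) = koebe_factor k"
    by (simp add: bounded_clinear_scaleC_complex[OF support_functionalsD(1)[OF l]]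
        support_functionalsD(2)[OF l] u)
  then have coeff: "l (frechet_D ?F (replicate (Suc m) z) 0)
        / (fact (Suc m) * complex_of_real (norm z ^ Suc m))
      = fps_nth (fps_expansion (koebe_factor k) 0) m" for m
    using normalized_coefficient[OF ex(1) _ lz zu \<open>z \<noteq> 0\<close>, of ?F m] by simp
  let ?c = "(real k + 2)\<^sup>2 / real k ^ 4 + 4 / (real k)\<^sup>2"
  \<comment> \<open>The square of \<open>2 * \<i> / k\<close> is negative, so the difference of the
    squares becomes the sum \<open>?c\<close>.\<close>
  have "(- ((of_nat k + 2) / (of_nat k)\<^sup>2))\<^sup>2 - (2 * \<i> / of_nat k)\<^sup>2 = complex_of_real ?c"
    by (simp add: power_divide power_mult_distrib)
  then have "cmod ((l (frechet_D ?F (replicate (2 * k + 1) z) 0)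
                    / (fact (2 * k + 1) * complex_of_real (norm z ^ (2 * k + 1))))\<^sup>2
               - (l (frechet_D ?F (replicate (k + 1) z) 0)
                    / (fact (k + 1) * complex_of_real (norm z ^ (k + 1))))\<^sup>2) = ?c"
    unfolding Suc_eq_plus1[symmetric] coeff koebe_factor_coeffs(2,3)[OF \<open>k \<ge> 1\<close>]
    by (simp only: norm_of_real) simp
  then show ?sharp
    using ex z lz by (intro exI[of _ ?f] exI[of _ ?F]) blast
qed

end
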